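(* Let $d\ge1$ and let $\boldsymbol{\alpha}=(\alpha_1,\dots,\alpha_d)$, $\boldsymbol{\ell}=(\ell_1,\dots,\ell_d)$ have positive elements. Let $(Y_m)_{m=1}^\infty$ be a sequence of sets such that each $Y_m\subset(0,1)$ consists of $m$ distinct points and, for some constant $c_{\mathrm{qu}}>0$, $h_{Y_m,(0,1)}\le c_{\mathrm{qu}}m^{-1}$ for every $m\ge1$. For $p,q\in\mathbb{N}$ let $Y_p^{q,+}=\{x+q-1 : x\in Y_p\}$, $Y_p^{q,-}=\{x-q : x\in Y_p\}$ and, for $k\in\mathbb{N}$, $$X_k=\bigcup_{m=1}^k\left(Y_{k-m+1}^{m,+}\cup Y_{k-m+1}^{m,-}\right).$$ For $\boldsymbol{k}=(k_1,\dots,k_d)\in\mathbb{N}^d$ consider the product grid $X_{\boldsymbol{k}}=X_{k_1}\times\cdots\times X_{k_d}\subset\mathbb{R}^d$ and let $n_i=\#X_{k_i}$. Let $\bar{h}_{0,i}=\min\{h_0(\ell_i),c_{\mathrm{qu}}^{-1}\}$, where $h_0(\ell_i)\in(0,1]$ is the constant fixed in the context. Then, for $i=1,\dots,d$, there are positive constants $C_i$, each of which only depends on $\ell_i$, $\alpha_i$ and $c_{\mathrm{qu}}$, such that $$e_{\boldsymbol{\alpha},\boldsymbol{\ell}}(Q^{\mathrm{opt}}_{\boldsymbol{\alpha},\boldsymbol{\ell},X_{\boldsymbol{k}}})\le\sum_{i=1}^d C_i\left[\prod_{j\neq i}\left(1+\frac{2\alpha_j^2}{\ell_j^2}\right)^{-1/4}\right]\exp\left(-\frac{\sqrt{n_i}}{2\sqrt{2}\,\alpha_i^2}\right)$$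 whenever $k_i\ge2c_{\mathrm{qu}}\bar{h}_{0,i}^{-1}$ for every $i=1,\dots,d$.
   Context: $I_{\boldsymbol{\alpha}}(f)=\int_{\mathbb{R}^d} f(\boldsymbol{x})\prod_{i=1}^d\left[\frac{1}{\sqrt{2\pi}\,\alpha_i}\exp(-x_i^2/(2\alpha_i^2))\right]d\boldsymbol{x}$; $K_{\boldsymbol{\ell}}(\boldsymbol{x},\boldsymbol{y})=\prod_{i=1}^d\exp(-(x_i-y_i)^2/(2\ell_i^2))$ is the Gaussian kernel on $\mathbb{R}^d$, with reproducing kernel Hilbert space $\mathcal{H}(K_{\boldsymbol{\ell}})$ and norm $\|\cdot\|_{\boldsymbol{\ell}}$. The worst-case error of an integration rule $Q$ is $e_{\boldsymbol{\alpha},\boldsymbol{\ell}}(Q)=\sup_{\|f\|_{\boldsymbol{\ell}}\le1}|I_{\boldsymbol{\alpha}}(f)-Q(f)|$. For a finite set $X=\{\boldsymbol{x}_1,\dots,\boldsymbol{x}_N\}\subset\mathbb{R}^d$ of distinct points, $Q^{\mathrm{opt}}_{\boldsymbol{\alpha},\boldsymbol{\ell},X}(f)=\sum_{i=1}^N w_i f(\boldsymbol{x}_i)$ is the rule on the points $X$ whose weights $(w_1,\dots,w_N)\in\mathbb{R}^N$ minimise the worst-case error $e_{\boldsymbol{\alpha},\boldsymbol{\ell}}$ among all weights in $\mathbb{R}^N$. In one dimension, with $K_\ell(x,y)=\exp(-(x-y)^2/(2\ell^2))$, the power function of a finite set $X\subset\mathbb{R}$ is $P_{\ell,X}(x)=\sup\{f(x)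 : f\in\mathcal{H}(K_\ell),\ \|f\|_\ell\le1,\ f(x_i)=0\text{ for all }x_i\in X\}$. The fill-distance of a finite set $X$ on a bounded set $\Omega\subset\mathbb{R}$ is $h_{X,\Omega}=\sup_{x\in\Omega}\min_{x_i\in X\cap\Omega}|x-x_i|$, understood as $+\infty$ if $X\cap\Omega=\emptyset$ ($X$ need not be a subset of $\Omega$). For each $\ell>0$, fix constants $A(\ell)>0$ and $h_0(\ell)\in(0,1]$, depending only on $\ell$, such that for every closed interval $\Omega\subset\mathbb{R}$ of length $1$ and every finite set $X\subset\mathbb{R}$ of distinct points, $\int_\Omega P_{\ell,X}(x)\,dx\le\exp\left(A(\ell)\log(h_{X,\Omega})\,h_{X,\Omega}^{-1}\right)$ whenever $h_{X,\Omega}\le h_0(\ell)$; such constants exist. *)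

theory Defs
  imports "HOL-Analysis.Analysis"
begin

section \<open>Reproducing kernel Hilbert spaces\<close>

text \<open>
  A real function on a set \<open>S\<close> is represented by its extension by zero to the whole type,
  so that the pointwise vector space operations need no adjustment outside \<open>S\<close>.
\<close>

definition function_hilbert_space ::
  "'a set \<Rightarrow> ('a \<Rightarrow> real) set \<Rightarrow> (('a \<Rightarrow> real) \<Rightarrow> ('a \<Rightarrow> real) \<Rightarrow> real) \<Rightarrow> bool" where
  "function_hilbert_space S H ip \<longleftrightarrow>
     (\<forall>f\<in>H. \<forall>x. x \<notin> S \<longrightarrow> f x = 0) \<and>
     (\<lambda>_. 0) \<in> H \<and>
     (\<forall>f\<in>H. \<forall>g\<in>H. (\<lambda>x. f x + g x) \<in> H) \<and>
     (\<forall>c. \<forall>f\<in>H. (\<lambda>x. c * f x) \<in> H) \<and>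
     (\<forall>f\<in>H. \<forall>g\<in>H. ip f g = ip g f) \<and>
     (\<forall>f\<in>H. \<forall>g\<in>H. \<forall>h\<in>H. ip (\<lambda>x. f x + g x) h = ip f h + ip g h) \<and>
     (\<forall>c. \<forall>f\<in>H. \<forall>g\<in>H. ip (\<lambda>x. c * f x) g = c * ip f g) \<and>
     (\<forall>f\<in>H. 0 \<le> ip f f) \<and>
     (\<forall>f\<in>H. ip f f = 0 \<longrightarrow> f = (\<lambda>_. 0)) \<and>
     (\<forall>F::nat \<Rightarrow> 'a \<Rightarrow> real.
        (\<forall>n. F n \<in> H) \<and>
        (\<forall>e>0. \<exists>N. \<forall>m\<ge>N. \<forall>n\<ge>N.
           sqrt (ip (\<lambda>x. F m x - F n x) (\<lambda>x. F m x - F n x)) < e) \<longrightarrow>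
        (\<exists>f\<in>H. (\<lambda>n. sqrt (ip (\<lambda>x. F n x - f x) (\<lambda>x. F n x - f x))) \<longlonglongrightarrow> 0))"

definition is_rkhs ::
  "'a set \<Rightarrow> ('a \<Rightarrow> 'a \<Rightarrow> real) \<Rightarrow> ('a \<Rightarrow> real) set \<Rightarrow>
   (('a \<Rightarrow> real) \<Rightarrow> ('a \<Rightarrow> real) \<Rightarrow> real) \<Rightarrow> bool" where
  "is_rkhs S K H ip \<longleftrightarrow>
     function_hilbert_space S H ip \<and>
     (\<forall>x\<in>S. (\<lambda>y. if y \<in> S then K y x else 0) \<in> H \<and>
        (\<forall>f\<in>H. ip f (\<lambda>y. if y \<in> S then K y x else 0) = f x))"

text \<open>
  For a positive semidefinite kernel the space exists and is unique, including the values of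
  the inner product on it (Moore--Aronszajn).  The choice below therefore only affects the
  irrelevant values of the inner product outside the space.
\<close>

definition rkhs ::
  "'a set \<Rightarrow> ('a \<Rightarrow> 'a \<Rightarrow> real) \<Rightarrow>
   ('a \<Rightarrow> real) set \<times> (('a \<Rightarrow> real) \<Rightarrow> ('a \<Rightarrow> real) \<Rightarrow> real)" where
  "rkhs S K = (SOME p. is_rkhs S K (fst p) (snd p))"

definition rkhs_funs :: "'a set \<Rightarrow> ('a \<Rightarrow> 'a \<Rightarrow> real) \<Rightarrow> ('a \<Rightarrow> real) set" where
  "rkhs_funs S K = fst (rkhs S K)"

definition rkhs_norm :: "'a set \<Rightarrow> ('a \<Rightarrow> 'a \<Rightarrow> real) \<Rightarrow> ('a \<Rightarrow> real) \<Rightarrow> real" where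
  "rkhs_norm S K f = sqrt (snd (rkhs S K) f f)"

section \<open>Gaussian integration and Gaussian kernels\<close>

text \<open>
  \<open>\<real>\<^sup>d\<close> is the set of extensional functions on \<open>{1..d}\<close>, the underlying space of the product
  measure \<open>Pi\<^sub>M {1..d} (\<lambda>_. lborel)\<close>.  The dimension is a number rather than a type so that
  constants can be quantified independently of it.
\<close>

abbreviation Rn :: "nat \<Rightarrow> (nat \<Rightarrow> real) set" where
  "Rn d \<equiv> PiE {1..d} (\<lambda>_. UNIV)"

definition gauss_integral ::
  "nat \<Rightarrow> (nat \<Rightarrow> real) \<Rightarrow> ((nat \<Rightarrow> real) \<Rightarrow> real) \<Rightarrow> real" where
  "gauss_integral d \<alpha> f =
     (\<integral>x. f x * (\<Prod>i=1..d. 1 / (sqrt (2 * pi) * \<alpha> i) * exp (- (x i)\<^sup>2 / (2 * (\<alpha> i)\<^sup>2)))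
        \<partial>(Pi\<^sub>M {1..d} (\<lambda>_. lborel)))"

definition gauss_kernel1 :: "real \<Rightarrow> real \<Rightarrow> real \<Rightarrow> real" where
  "gauss_kernel1 l x y = exp (- (x - y)\<^sup>2 / (2 * l\<^sup>2))"

definition gauss_kernel :: "nat \<Rightarrow> (nat \<Rightarrow> real) \<Rightarrow> (nat \<Rightarrow> real) \<Rightarrow> (nat \<Rightarrow> real) \<Rightarrow> real" where
  "gauss_kernel d l x y = (\<Prod>i=1..d. exp (- (x i - y i)\<^sup>2 / (2 * (l i)\<^sup>2)))"

section \<open>Integration rules\<close>

definition worst_case_error ::
  "nat \<Rightarrow> (nat \<Rightarrow> real) \<Rightarrow> (nat \<Rightarrow> real) \<Rightarrow> (((nat \<Rightarrow> real) \<Rightarrow> real) \<Rightarrow> real) \<Rightarrow> real" where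
  "worst_case_error d \<alpha> l Q =
     (SUP f\<in>{f \<in> rkhs_funs (Rn d) (gauss_kernel d l). rkhs_norm (Rn d) (gauss_kernel d l) f \<le> 1}.
        \<bar>gauss_integral d \<alpha> f - Q f\<bar>)"

text \<open>Weights are indexed by the points themselves; their values off the point set are irrelevant.\<close>

definition quad_rule :: "'a set \<Rightarrow> ('a \<Rightarrow> real) \<Rightarrow> ('a \<Rightarrow> real) \<Rightarrow> real" where
  "quad_rule X w f = (\<Sum>x\<in>X. w x * f x)"

definition opt_weights ::
  "nat \<Rightarrow> (nat \<Rightarrow> real) \<Rightarrow> (nat \<Rightarrow> real) \<Rightarrow> (nat \<Rightarrow> real) set \<Rightarrow> (nat \<Rightarrow> real) \<Rightarrow> real" where
  "opt_weights d \<alpha> l X = arg_min (\<lambda>w. worst_case_error d \<alpha> l (quad_rule X w)) (\<lambda>_. True)"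

definition Q_opt ::
  "nat \<Rightarrow> (nat \<Rightarrow> real) \<Rightarrow> (nat \<Rightarrow> real) \<Rightarrow> (nat \<Rightarrow> real) set \<Rightarrow> ((nat \<Rightarrow> real) \<Rightarrow> real) \<Rightarrow> real" where
  "Q_opt d \<alpha> l X = quad_rule X (opt_weights d \<alpha> l X)"

section \<open>Power function and fill-distance\<close>

definition power_function :: "real \<Rightarrow> real set \<Rightarrow> real \<Rightarrow> real" where
  "power_function l X x =
     Sup {f x |f. f \<in> rkhs_funs UNIV (gauss_kernel1 l) \<and>
                  rkhs_norm UNIV (gauss_kernel1 l) f \<le> 1 \<and> (\<forall>y\<in>X. f y = 0)}"

text \<open>In \<open>ereal\<close> the infimum over the empty set is \<open>\<infinity>\<close>, which gives the convention for \<open>X \<inter> \<Omega> = {}\<close>.\<close>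

definition fill_distance :: "real set \<Rightarrow> real set \<Rightarrow> ereal" where
  "fill_distance X \<Omega> = (SUP x\<in>\<Omega>. INF y\<in>X \<inter> \<Omega>. ereal \<bar>x - y\<bar>)"

section \<open>The point sets\<close>

definition shift_pos :: "(nat \<Rightarrow> real set) \<Rightarrow> nat \<Rightarrow> nat \<Rightarrow> real set" where
  "shift_pos Y p q = (\<lambda>x. x + real q - 1) ` Y p"

definition shift_neg :: "(nat \<Rightarrow> real set) \<Rightarrow> nat \<Rightarrow> nat \<Rightarrow> real set" where
  "shift_neg Y p q = (\<lambda>x. x - real q) ` Y p"

definition X_points :: "(nat \<Rightarrow> real set) \<Rightarrow> nat \<Rightarrow> real set" where
  "X_points Y k = (\<Union>m\<in>{1..k}. shift_pos Y (k - m + 1) m \<union> shift_neg Y (k - m + 1) m)"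

definition X_grid :: "(nat \<Rightarrow> real set) \<Rightarrow> nat \<Rightarrow> (nat \<Rightarrow> nat) \<Rightarrow> (nat \<Rightarrow> real) set" where
  "X_grid Y d k = PiE {1..d} (\<lambda>i. X_points Y (k i))"

end

theory Submission
  imports Defs "HOL-Probability.Distributions"
begin

text \<open>
  The integral is a bounded functional on the Gaussian space, represented there by some \<open>\<mu>\<close>, and the
  worst-case error of a rule with weights \<open>w\<close> is the norm of \<open>\<mu> - (\<Sum>x\<in>X. w x * K x)\<close>. For optimal weights this
  residual \<open>r\<close> vanishes on the points, so the squared error is \<open>M - q\<close> with \<open>M\<close> and \<open>q\<close> the squared norms
  of \<open>\<mu>\<close> and of the representer of the rule. The product of optimal one-dimensional rules has squared
  error \<open>\<Prod>M i - \<Prod>q i\<close>, which telescopes into the sum over the coordinates, and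
  \<open>M i = (1 + 2 * (\<alpha> i)\<^sup>2 / (l i)\<^sup>2) powr (- 1 / 2)\<close>.

  In one dimension the squared error is the Gaussian integral of \<open>r\<close>, hence the error is at most the
  Gaussian integral of the power function. The unit intervals within distance \<open>k / 2\<close> of the origin
  have fill-distance at most \<open>2 * c / k\<close> and contribute superexponentially little; the remaining Gaussian
  tail is bounded by a multiple of \<open>exp (- k / (2 * a\<^sup>2))\<close>, and there are at most \<open>2 * k\<^sup>2\<close> points.
\<close>

section \<open>Positive semidefinite kernels\<close>

text \<open>The choice in \<open>rkhs\<close> says nothing about the space until some space is known
  to exist, so existence is proved before anything else; afterwards every fact is drawn from
  \<open>is_rkhs\<close>. The Bochner integral of a non-integrable function is 0, so linearity of
  the integral rests on every element of the space being measurable and bounded; both come from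
  Cauchy-Schwarz against kernel sections.

  Why the power function controls the error: \<open>r\<close> vanishes on the points, so its squared
  norm is its own integral, and pointwise \<open>r\<close> is at most its norm times the power
  function; one factor of the norm cancels.

  Where the rate comes from: the outer unit intervals hold few points, so the power function is used
  only out to half the radius of the point set, where every unit interval still has at least k/2
  points. Beyond that, half of the Gaussian exponent is traded for a linear decay
  \<open>exp (- t * M)\<close>; \<open>t = 1 / a^2\<close> and \<open>M >= k / 2\<close> give the
  stated exponent in \<open>k\<close>, and \<open>n <= 2 * k^2\<close> turns \<open>k\<close> into
  at least sqrt(n / 2).\<close>

lemma discriminant_bound:
  fixes a b c :: real
  assumes "\<And>t. 0 \<le> a + 2 * t * b + t\<^sup>2 * c" and "0 \<le> c"
  shows "b\<^sup>2 \<le> a * c"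
proof (cases "c = 0")
  case True
  have "b = 0"
  proof (rule ccontr)
    assume "b \<noteq> 0"
    \<comment> \<open>With \<open>c = 0\<close> the expression is affine in \<open>t\<close>; at
      this \<open>t\<close> it equals a - (a + 1) = -1.\<close>
    then show False
      using assms(1)[of "- (a + 1) / (2 * b)"] True by (simp add: field_simps)
  qed
  then show ?thesis using True by simp
next
  case False
  then have "c > 0" using assms(2) by simp
  then show ?thesis
    using assms(1)[of "- b / c"] by (simp add: field_simps power2_eq_square)
qed

definition kform :: "('a \<Rightarrow> 'a \<Rightarrow> real) \<Rightarrow> 'a set \<Rightarrow> ('a \<Rightarrow> real) \<Rightarrow> ('a \<Rightarrow> real) \<Rightarrow> real" where
  "kform K X v w = (\<Sum>x\<in>X. v x * (\<Sum>y\<in>X. w y * K x y))"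

lemma kform_add_left: "kform K X (\<lambda>x. u x + v x) w = kform K X u w + kform K X v w"
  by (simp add: kform_def sum.distrib algebra_simps)

lemma kform_scale_left: "kform K X (\<lambda>x. c * v x) w = c * kform K X v w"
  by (simp add: kform_def sum_distrib_left algebra_simps)

lemma kform_add_right: "kform K X w (\<lambda>x. u x + v x) = kform K X w u + kform K X w v"
  by (simp add: kform_def sum.distrib algebra_simps)

lemma kform_scale_right: "kform K X w (\<lambda>x. c * v x) = c * kform K X w v"
  by (simp add: kform_def sum_distrib_left algebra_simps)

definition represents :: "('a \<Rightarrow> 'a \<Rightarrow> real) \<Rightarrow> 'a set \<Rightarrow> ('a \<Rightarrow> real) \<Rightarrow> ('a \<Rightarrow> real) \<Rightarrow> bool" where
  "represents K X w f \<longleftrightarrow> (\<forall>x\<in>X. (\<Sum>y\<in>X. w y * K x y) = f x)"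

text \<open>In matrix terms, B K - f f^T is positive semidefinite on \<open>X\<close>. For positive
  semidefinite \<open>K\<close> the least nonnegative such \<open>B\<close>, if there is one, is the
  squared norm of the kernel interpolant of \<open>f\<close> on \<open>X\<close>.\<close>

definition kbounded :: "('a \<Rightarrow> 'a \<Rightarrow> real) \<Rightarrow> 'a set \<Rightarrow> ('a \<Rightarrow> real) \<Rightarrow> real \<Rightarrow> bool" where
  "kbounded K X f B \<longleftrightarrow> (\<forall>w. (\<Sum>x\<in>X. w x * f x)\<^sup>2 \<le> B * kform K X w w)"

lemma kform_represents: "represents K X w f \<Longrightarrow> kform K X v w = (\<Sum>x\<in>X. v x * f x)"
  by (simp add: kform_def represents_def cong: sum.cong)

lemma represents_add:
  "represents K X v f \<Longrightarrow> represents K X w g \<Longrightarrow> represents K X (\<lambda>x. v x + w x) (\<lambda>x. f x + g x)"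
  by (simp add: represents_def sum.distrib algebra_simps)

lemma represents_scale:
  "represents K X w f \<Longrightarrow> represents K X (\<lambda>x. c * w x) (\<lambda>x. c * f x)"
  by (simp add: represents_def sum_distrib_left[symmetric] mult.assoc)

lemma sum_zero_extend:
  fixes w :: "'a \<Rightarrow> real"
  assumes "finite Z" "X \<subseteq> Z"
  shows "(\<Sum>x\<in>Z. (if x \<in> X then w x else 0) * f x) = (\<Sum>x\<in>X. w x * f x)"
proof -
  have "(\<Sum>x\<in>Z. (if x \<in> X then w x else 0) * f x) = (\<Sum>x\<in>Z. if x \<in> X then w x * f x else 0)"
    by (rule sum.cong) auto
  also have "\<dots> = (\<Sum>x\<in>Z \<inter> X. w x * f x)"
    using assms(1) by (simp add: sum.inter_restrict)
  also have "Z \<inter> X = X" using assms(2) by blast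
  finally show ?thesis .
qed

lemma kform_zero_extend:
  assumes "finite Z" "X \<subseteq> Z"
  shows "kform K Z (\<lambda>x. if x \<in> X then v x else 0) (\<lambda>x. if x \<in> X then w x else 0) = kform K X v w"
  using assms by (simp add: kform_def sum_zero_extend)

lemma kbounded_subset:
  assumes "finite Z" "X \<subseteq> Z" "kbounded K Z f B"
  shows "kbounded K X f B"
  unfolding kbounded_def
proof
  fix w
  show "(\<Sum>x\<in>X. w x * f x)\<^sup>2 \<le> B * kform K X w w"
    using assms(3)[unfolded kbounded_def, rule_format, of "\<lambda>x. if x \<in> X then w x else 0"]
    by (simp only: sum_zero_extend[OF assms(1,2)] kform_zero_extend[OF assms(1,2)])
qed

locale psd_kernel =
  fixes S :: "'a set" and K :: "'a \<Rightarrow> 'a \<Rightarrow> real"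
  assumes sym: "x \<in> S \<Longrightarrow> y \<in> S \<Longrightarrow> K x y = K y x"
    and nonneg: "finite X \<Longrightarrow> X \<subseteq> S \<Longrightarrow> 0 \<le> kform K X w w"
begin

lemma kform_sym:
  assumes "X \<subseteq> S"
  shows "kform K X v w = kform K X w v"
proof -
  have "kform K X v w = (\<Sum>x\<in>X. \<Sum>y\<in>X. v x * w y * K x y)"
    by (simp add: kform_def sum_distrib_left mult.assoc)
  also have "\<dots> = (\<Sum>y\<in>X. \<Sum>x\<in>X. v x * w y * K x y)" by (rule sum.swap)
  also have "\<dots> = (\<Sum>y\<in>X. \<Sum>x\<in>X. w y * (v x * K y x))"
    using assms by (intro sum.cong refl) (auto simp: sym subset_iff)
  also have "\<dots> = kform K X w v" by (simp add: kform_def sum_distrib_left)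
  finally show ?thesis .
qed

lemma kform_cauchy_schwarz:
  assumes "finite X" "X \<subseteq> S"
  shows "(kform K X v w)\<^sup>2 \<le> kform K X v v * kform K X w w"
proof (rule discriminant_bound)
  fix t
  have "0 \<le> kform K X (\<lambda>x. v x + t * w x) (\<lambda>x. v x + t * w x)"
    using assms by (rule nonneg)
  then show "0 \<le> kform K X v v + 2 * t * kform K X v w + t\<^sup>2 * kform K X w w"
    using kform_sym[OF assms(2), of w v]
    by (simp add: kform_add_left kform_add_right kform_scale_left kform_scale_right
        power2_eq_square algebra_simps)
qed (use assms nonneg in blast)

lemma kbounded_represents:
  assumes "finite X" "X \<subseteq> S" "represents K X w f"
  shows "kbounded K X f (\<Sum>x\<in>X. w x * f x)"
  unfolding kbounded_def
proof
  fix v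
  show "(\<Sum>x\<in>X. v x * f x)\<^sup>2 \<le> (\<Sum>x\<in>X. w x * f x) * kform K X v v"
    using kform_cauchy_schwarz[OF assms(1,2), of w v] kform_sym[OF assms(2), of w v]
    by (simp only: kform_represents[OF assms(3)])
qed

text \<open>Once \<open>z\<close> joins the set, the kernel section at \<open>z\<close> is
  represented by the unit weight at \<open>z\<close>; restricting back to \<open>X\<close> keeps the
  constant.\<close>

lemma kbounded_kernel:
  assumes "finite X" "X \<subseteq> S" "z \<in> S"
  shows "kbounded K X (\<lambda>x. K x z) (K z z)"
proof -
  let ?Z = "insert z X"
  have Z: "finite ?Z" "?Z \<subseteq> S" using assms by auto
  have "represents K ?Z (\<lambda>x. if x \<in> {z} then 1 else 0) (\<lambda>x. K x z)"
    unfolding represents_def using Z(1) by (subst sum_zero_extend) auto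
  moreover have "(\<Sum>x\<in>?Z. (if x \<in> {z} then 1 else 0) * K x z) = K z z"
    using Z(1) by (subst sum_zero_extend) auto
  ultimately have "kbounded K ?Z (\<lambda>x. K x z) (K z z)"
    using kbounded_represents[OF Z] by metis
  then show ?thesis by (rule kbounded_subset[OF Z(1) subset_insertI])
qed

text \<open>The Gram matrix may be singular, so it is not inverted; one Gram-Schmidt step adds a
  point \<open>z\<close>. If \<open>u\<close> represents the section at \<open>z\<close> on
  \<open>X\<close>, then \<open>v\<close>, the unit weight at \<open>z\<close> minus
  \<open>u\<close>, is orthogonal to \<open>X\<close>: its kernel sum vanishes on \<open>X\<close>
  and is the Schur complement \<open>s\<close> at \<open>z\<close>. The old weights leave a defect
  \<open>r\<close> at \<open>z\<close> only, which \<open>r / s * v\<close> repairs. If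
  \<open>s = 0\<close>, then \<open>v\<close> has form 0 and \<open>kbounded\<close> forces its sum
  against \<open>f\<close> to vanish, which says that \<open>r = 0\<close>.\<close>

lemma represents_exists:
  assumes "finite X" "X \<subseteq> S" "kbounded K X f B"
  shows "\<exists>w. represents K X w f"
  using assms
proof (induction X arbitrary: f B rule: finite_induct)
  case empty
  then show ?case by (simp add: represents_def)
next
  case (insert z X)
  have XS: "X \<subseteq> S" and zS: "z \<in> S" using insert.prems by auto
  have "kbounded K X f B"
    by (rule kbounded_subset[OF _ _ insert.prems(2)]) (use insert.hyps in auto)
  then obtain w where w: "represents K X w f" using insert.IH[OF XS] by blast
  obtain u where u: "represents K X u (\<lambda>x. K x z)"
    using insert.IH[OF XS kbounded_kernel[OF insert.hyps(1) XS zS]] by blast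
  define s where "s = K z z - (\<Sum>y\<in>X. u y * K z y)"
  define r where "r = f z - (\<Sum>y\<in>X. w y * K z y)"
  define v where "v = (\<lambda>x. if x = z then 1 else - u x)"
  have on_X: "(\<Sum>y\<in>X. v y * g y) = - (\<Sum>y\<in>X. u y * g y)" for g
    unfolding sum_negf[symmetric] by (rule sum.cong) (use insert.hyps(2) in \<open>auto simp: v_def\<close>)
  have vz: "v z = 1" by (simp add: v_def)
  have Kv: "(\<Sum>y\<in>insert z X. v y * K x y) = (if x = z then s else 0)" if "x \<in> insert z X" for x
  proof -
    have "(\<Sum>y\<in>insert z X. v y * K x y) = K x z - (\<Sum>y\<in>X. u y * K x y)"
      using insert.hyps by (simp add: on_X vz)
    then show ?thesis
      using that insert.hyps(2) u by (auto simp: s_def represents_def)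
  qed
  have vv: "kform K (insert z X) v v = s"
  proof -
    have "kform K (insert z X) v v = (\<Sum>x\<in>insert z X. v x * (if x = z then s else 0))"
      unfolding kform_def by (intro sum.cong refl arg_cong2[where f = "(*)"] Kv)
    also have "\<dots> = (\<Sum>x\<in>insert z X. if x = z then s else 0)"
      by (rule sum.cong) (auto simp: v_def)
    also have "\<dots> = s" using insert.hyps by simp
    finally show ?thesis .
  qed
  let ?w0 = "\<lambda>x. if x \<in> X then w x else 0"
  have w0: "(\<Sum>y\<in>insert z X. ?w0 y * K x y) = (\<Sum>y\<in>X. w y * K x y)" for x
    using insert.hyps by (intro sum_zero_extend) auto
  have r: "s = 0 \<Longrightarrow> r = 0"
  proof -
    assume "s = 0"
    then have "(\<Sum>x\<in>insert z X. v x * f x)\<^sup>2 \<le> 0"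
      using insert.prems(2)[unfolded kbounded_def, rule_format, of v] vv by simp
    then have "(\<Sum>x\<in>insert z X. v x * f x) = 0" by simp
    then have "f z = (\<Sum>y\<in>X. u y * f y)"
      using insert.hyps by (simp add: on_X vz)
    also have "\<dots> = kform K X u w" using w by (simp add: kform_represents)
    also have "\<dots> = kform K X w u" using XS by (rule kform_sym)
    also have "\<dots> = (\<Sum>y\<in>X. w y * K y z)" using u by (simp add: kform_represents)
    also have "\<dots> = (\<Sum>y\<in>X. w y * K z y)"
      using XS zS by (intro sum.cong refl) (auto simp: sym subset_iff)
    finally show "r = 0" by (simp add: r_def)
  qed
  have "represents K (insert z X) (\<lambda>x. ?w0 x + r / s * v x) f"
    unfolding represents_def
  proof
    fix x assume x: "x \<in> insert z X"
    have "(\<Sum>y\<in>insert z X. (?w0 y + r / s * v y) * K x y) =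
       (\<Sum>y\<in>insert z X. ?w0 y * K x y) + r / s * (\<Sum>y\<in>insert z X. v y * K x y)"
      unfolding sum_distrib_left sum.distrib[symmetric]
      by (intro sum.cong refl) (simp add: algebra_simps)
    also have "\<dots> = (\<Sum>y\<in>X. w y * K x y) + r / s * (if x = z then s else 0)"
      unfolding w0 Kv[OF x] ..
    \<comment> \<open>If \<open>s = 0\<close>, then \<open>r = 0\<close> as well, and
      \<open>r / s * s\<close> is still \<open>r\<close> because division by zero gives 0.\<close>
    also have "\<dots> = f x"
      using x w r insert.hyps(2) by (auto simp: r_def represents_def)
    finally show "(\<Sum>y\<in>insert z X. (?w0 y + r / s * v y) * K x y) = f x" .
  qed
  then show ?case by blast
qed

end

section \<open>The Moore--Aronszajn theorem\<close>

context psd_kernel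
begin

text \<open>
  \<open>ipX X f g\<close> is the inner product of the kernel interpolants of \<open>f\<close> and \<open>g\<close> on the finite set \<open>X\<close>.
  For \<open>f = g\<close> it increases with \<open>X\<close>, so on functions with bounded interpolants it converges along
  the finite subsets of \<open>S\<close>. The kernel need not be strictly positive definite:
  \<open>kbounded\<close> is exactly the condition under which interpolation on \<open>X\<close> is possible.
\<close>

definition maH :: "('a \<Rightarrow> real) set" where
  "maH = {f. (\<forall>x. x \<notin> S \<longrightarrow> f x = 0) \<and>
             (\<exists>B. \<forall>X. finite X \<longrightarrow> X \<subseteq> S \<longrightarrow> kbounded K X f B)}"

definition weights :: "'a set \<Rightarrow> ('a \<Rightarrow> real) \<Rightarrow> 'a \<Rightarrow> real" where
  "weights X f = (SOME w. represents K X w f)"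

definition ipX :: "'a set \<Rightarrow> ('a \<Rightarrow> real) \<Rightarrow> ('a \<Rightarrow> real) \<Rightarrow> real" where
  "ipX X f g = (\<Sum>x\<in>X. weights X f x * g x)"

definition ip :: "('a \<Rightarrow> real) \<Rightarrow> ('a \<Rightarrow> real) \<Rightarrow> real" where
  "ip f g = Lim (finite_subsets_at_top S) (\<lambda>X. ipX X f g)"

lemma maHI:
  assumes "\<And>x. x \<notin> S \<Longrightarrow> f x = 0"
    and "\<And>X w. finite X \<Longrightarrow> X \<subseteq> S \<Longrightarrow> (\<Sum>x\<in>X. w x * f x)\<^sup>2 \<le> B * kform K X w w"
  shows "f \<in> maH"
  using assms unfolding maH_def kbounded_def by blast

lemma maHE:
  assumes "f \<in> maH"
  obtains B where "0 \<le> B"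
    "\<And>X w. finite X \<Longrightarrow> X \<subseteq> S \<Longrightarrow> (\<Sum>x\<in>X. w x * f x)\<^sup>2 \<le> B * kform K X w w"
proof -
  obtain B where B: "\<forall>X. finite X \<longrightarrow> X \<subseteq> S \<longrightarrow> kbounded K X f B"
    using assms unfolding maH_def by blast
  show thesis
  proof (rule that[of "max 0 B"])
    fix X w assume X: "finite X" "X \<subseteq> S"
    then have "(\<Sum>x\<in>X. w x * f x)\<^sup>2 \<le> B * kform K X w w"
      using B unfolding kbounded_def by blast
    also have "\<dots> \<le> max 0 B * kform K X w w"
      using nonneg[OF X] by (intro mult_right_mono) auto
    finally show "(\<Sum>x\<in>X. w x * f x)\<^sup>2 \<le> max 0 B * kform K X w w" .
  qed simp
qed

lemma maH_zero: "f \<in> maH \<Longrightarrow> x \<notin> S \<Longrightarrow> f x = 0"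
  by (simp add: maH_def)

lemma represents_weights:
  assumes "f \<in> maH" "finite X" "X \<subseteq> S"
  shows "represents K X (weights X f) f"
proof -
  obtain B where "\<And>w. (\<Sum>x\<in>X. w x * f x)\<^sup>2 \<le> B * kform K X w w"
    using maHE[OF assms(1)] assms(2,3) by metis
  then have "\<exists>w. represents K X w f"
    by (intro represents_exists[OF assms(2,3)]) (auto simp: kbounded_def)
  then show ?thesis unfolding weights_def by (rule someI_ex)
qed

lemma maH_scale:
  assumes "f \<in> maH"
  shows "(\<lambda>x. c * f x) \<in> maH"
proof -
  obtain B where B: "\<And>X w. finite X \<Longrightarrow> X \<subseteq> S \<Longrightarrow> (\<Sum>x\<in>X. w x * f x)\<^sup>2 \<le> B * kform K X w w"
    using assms(1) by (rule maHE) (rule that)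
  have "(\<Sum>x\<in>X. w x * (c * f x))\<^sup>2 \<le> (c\<^sup>2 * B) * kform K X w w" if "finite X" "X \<subseteq> S" for X w
  proof -
    have "(\<Sum>x\<in>X. w x * (c * f x)) = c * (\<Sum>x\<in>X. w x * f x)"
      by (simp add: sum_distrib_left algebra_simps)
    then show ?thesis
      using mult_left_mono[OF B[OF that, of w], of "c\<^sup>2"] by (simp add: power_mult_distrib mult.assoc)
  qed
  moreover have "c * f x = 0" if "x \<notin> S" for x
    using maH_zero[OF assms that] by simp
  ultimately show ?thesis by (intro maHI)
qed

lemma maH_add:
  assumes "f \<in> maH" "g \<in> maH"
  shows "(\<lambda>x. f x + g x) \<in> maH"
proof -
  obtain B where B: "\<And>X w. finite X \<Longrightarrow> X \<subseteq> S \<Longrightarrow> (\<Sum>x\<in>X. w x * f x)\<^sup>2 \<le> B * kform K X w w"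
    using assms(1) by (rule maHE) (rule that)
  obtain C where C: "\<And>X w. finite X \<Longrightarrow> X \<subseteq> S \<Longrightarrow> (\<Sum>x\<in>X. w x * g x)\<^sup>2 \<le> C * kform K X w w"
    using assms(2) by (rule maHE) (rule that)
  have "(\<Sum>x\<in>X. w x * (f x + g x))\<^sup>2 \<le> (2 * B + 2 * C) * kform K X w w"
    if "finite X" "X \<subseteq> S" for X w
  proof -
    have "(\<Sum>x\<in>X. w x * (f x + g x)) = (\<Sum>x\<in>X. w x * f x) + (\<Sum>x\<in>X. w x * g x)"
      by (simp add: sum.distrib algebra_simps)
    moreover have "(a + b)\<^sup>2 \<le> 2 * a\<^sup>2 + 2 * b\<^sup>2" for a b :: real
      using zero_le_power2[of "a - b"] by (simp add: power2_eq_square algebra_simps)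
    ultimately have "(\<Sum>x\<in>X. w x * (f x + g x))\<^sup>2 \<le>
        2 * (\<Sum>x\<in>X. w x * f x)\<^sup>2 + 2 * (\<Sum>x\<in>X. w x * g x)\<^sup>2" by simp
    also have "\<dots> \<le> 2 * (B * kform K X w w) + 2 * (C * kform K X w w)"
      using B[OF that, of w] C[OF that, of w] by (intro add_mono) auto
    finally show ?thesis by (simp add: algebra_simps)
  qed
  moreover have "f x + g x = 0" if "x \<notin> S" for x
    using maH_zero[OF assms(1) that] maH_zero[OF assms(2) that] by simp
  ultimately show ?thesis by (intro maHI)
qed

lemma maH_diff: "f \<in> maH \<Longrightarrow> g \<in> maH \<Longrightarrow> (\<lambda>x. f x - g x) \<in> maH"
  using maH_add[of f "\<lambda>x. - 1 * g x"] maH_scale[of g "- 1"] by simp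

text \<open>For a singular Gram matrix the interpolation weights are not unique. The value does not
  depend on the choice because \<open>g\<close> is represented too: symmetry moves the form onto the
  weights of \<open>g\<close>, where only the values of \<open>f\<close> enter, and then
  back.\<close>

lemma ipX_eq:
  assumes "f \<in> maH" "g \<in> maH" "finite X" "X \<subseteq> S" "represents K X w f"
  shows "ipX X f g = (\<Sum>x\<in>X. w x * g x)"
proof -
  have "ipX X f g = kform K X (weights X f) (weights X g)"
    unfolding ipX_def by (rule kform_represents[symmetric]) (use assms represents_weights in auto)
  also have "\<dots> = kform K X (weights X g) (weights X f)" using assms by (intro kform_sym)
  also have "\<dots> = (\<Sum>x\<in>X. weights X g x * f x)"
    by (rule kform_represents) (use assms represents_weights in auto)
  also have "\<dots> = kform K X (weights X g) w" using assms by (simp add: kform_represents)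
  also have "\<dots> = kform K X w (weights X g)" using assms by (intro kform_sym)
  also have "\<dots> = (\<Sum>x\<in>X. w x * g x)"
    by (rule kform_represents) (use assms represents_weights in auto)
  finally show ?thesis .
qed

lemma ipX_kform:
  assumes "f \<in> maH" "g \<in> maH" "finite X" "X \<subseteq> S"
  shows "ipX X f g = kform K X (weights X f) (weights X g)"
  unfolding ipX_def
  by (rule kform_represents[symmetric]) (rule represents_weights[OF assms(2-4)])

lemma ipX_sym:
  assumes "f \<in> maH" "g \<in> maH" "finite X" "X \<subseteq> S"
  shows "ipX X f g = ipX X g f"
  using assms by (simp add: ipX_kform kform_sym)

lemma ipX_add:
  assumes "f \<in> maH" "g \<in> maH" "h \<in> maH" "finite X" "X \<subseteq> S"
  shows "ipX X (\<lambda>x. f x + g x) h = ipX X f h + ipX X g h"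
proof -
  have "ipX X (\<lambda>x. f x + g x) h = (\<Sum>x\<in>X. (weights X f x + weights X g x) * h x)"
    using assms by (intro ipX_eq maH_add represents_add represents_weights)
  then show ?thesis by (simp add: ipX_def sum.distrib algebra_simps)
qed

lemma ipX_scale:
  assumes "f \<in> maH" "h \<in> maH" "finite X" "X \<subseteq> S"
  shows "ipX X (\<lambda>x. c * f x) h = c * ipX X f h"
proof -
  have "ipX X (\<lambda>x. c * f x) h = (\<Sum>x\<in>X. (c * weights X f x) * h x)"
    using assms by (intro ipX_eq maH_scale represents_scale represents_weights)
  then show ?thesis by (simp add: ipX_def sum_distrib_left algebra_simps)
qed

lemma ipX_nonneg: "f \<in> maH \<Longrightarrow> finite X \<Longrightarrow> X \<subseteq> S \<Longrightarrow> 0 \<le> ipX X f f"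
  by (simp add: ipX_kform nonneg)

text \<open>The interpolant on \<open>X\<close> is the orthogonal projection of the interpolant on
  \<open>Z\<close>: their inner product \<open>wv\<close> equals the smaller squared norm
  \<open>ww\<close>, so the difference of the squared norms is the squared norm of the
  difference.\<close>

lemma ipX_mono:
  assumes f: "f \<in> maH" and Z: "finite Z" "Z \<subseteq> S" and XZ: "X \<subseteq> Z"
  shows "ipX X f f \<le> ipX Z f f"
proof -
  have X: "finite X" "X \<subseteq> S" using Z XZ finite_subset by auto
  let ?w = "\<lambda>x. if x \<in> X then weights X f x else 0"
  let ?v = "weights Z f"
  have vv: "kform K Z ?v ?v = ipX Z f f" using f Z by (simp add: ipX_kform)
  have ww: "kform K Z ?w ?w = ipX X f f"
    using f X Z XZ by (simp add: kform_zero_extend ipX_kform)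
  have wv: "kform K Z ?w ?v = ipX X f f"
    using kform_represents[OF represents_weights[OF f Z], of ?w] sum_zero_extend[OF Z(1) XZ]
    by (simp add: ipX_def)
  have "0 \<le> kform K Z (\<lambda>x. ?v x + (- 1) * ?w x) (\<lambda>x. ?v x + (- 1) * ?w x)"
    using Z by (intro nonneg)
  also have "\<dots> = ipX Z f f - ipX X f f"
    unfolding kform_add_left kform_add_right kform_scale_left kform_scale_right vv ww wv
      kform_sym[OF Z(2), of ?v ?w] by simp
  finally show ?thesis by simp
qed

lemma ipX_le:
  assumes "f \<in> maH" "finite X" "X \<subseteq> S" "kbounded K X f B" "0 \<le> B"
  shows "ipX X f f \<le> B"
proof (cases "ipX X f f = 0")
  case False
  then have pos: "0 < ipX X f f" using assms ipX_nonneg[of f X] by simp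
  \<comment> \<open>The bound is tested on the interpolation weights of \<open>f\<close> itself, for
    which both sides are expressed by \<open>ipX X f f\<close>.\<close>
  have "(ipX X f f)\<^sup>2 \<le> B * ipX X f f"
    using assms(4)[unfolded kbounded_def, rule_format, of "weights X f"] assms
    by (simp add: ipX_kform[symmetric] ipX_def[symmetric])
  then show ?thesis using pos by (simp add: power2_eq_square)
qed (use assms in simp)

lemma ipX_diag_tendsto:
  assumes f: "f \<in> maH"
  shows "\<exists>l. ((\<lambda>X. ipX X f f) \<longlongrightarrow> l) (finite_subsets_at_top S)"
proof -
  define A where "A = {ipX X f f |X. finite X \<and> X \<subseteq> S}"
  obtain B where "0 \<le> B"
    and B: "\<And>X w. finite X \<Longrightarrow> X \<subseteq> S \<Longrightarrow> (\<Sum>x\<in>X. w x * f x)\<^sup>2 \<le> B * kform K X w w"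
    using f by (rule maHE) (rule that)
  have le: "ipX X f f \<le> B" if "finite X" "X \<subseteq> S" for X
    by (rule ipX_le[OF f that]) (use B[OF that] \<open>0 \<le> B\<close> in \<open>auto simp: kbounded_def\<close>)
  have bdd: "bdd_above A" unfolding A_def using le by (intro bdd_aboveI[of _ B]) auto
  have "((\<lambda>X. ipX X f f) \<longlongrightarrow> Sup A) (finite_subsets_at_top S)"
  proof (rule increasing_tendsto)
    show "\<forall>\<^sub>F X in finite_subsets_at_top S. ipX X f f \<le> Sup A"
      by (intro eventually_finite_subsets_at_top_weakI cSup_upper bdd) (auto simp: A_def)
    fix l assume "l < Sup A"
    moreover have "A \<noteq> {}" unfolding A_def by blast
    ultimately obtain X where X: "finite X" "X \<subseteq> S" "l < ipX X f f"
      using bdd by (auto simp: less_cSup_iff A_def)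
    show "\<forall>\<^sub>F Z in finite_subsets_at_top S. l < ipX Z f f"
      unfolding eventually_finite_subsets_at_top
    proof (intro exI[of _ X] conjI allI impI)
      fix Z assume "finite Z \<and> X \<subseteq> Z \<and> Z \<subseteq> S"
      then show "l < ipX Z f f" using ipX_mono[OF f, of Z X] X by simp
    qed (use X in auto)
  qed
  then show ?thesis by blast
qed

text \<open>Monotonicity is available on the diagonal only; the mixed values converge by
  polarisation.\<close>

lemma ip_tendsto:
  assumes f: "f \<in> maH" and g: "g \<in> maH"
  shows "((\<lambda>X. ipX X f g) \<longlongrightarrow> ip f g) (finite_subsets_at_top S)"
proof -
  have fg: "(\<lambda>x. f x + g x) \<in> maH" using f g by (rule maH_add)
  obtain a where a: "((\<lambda>X. ipX X f f) \<longlongrightarrow> a) (finite_subsets_at_top S)"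
    using ipX_diag_tendsto[OF f] by blast
  obtain b where b: "((\<lambda>X. ipX X g g) \<longlongrightarrow> b) (finite_subsets_at_top S)"
    using ipX_diag_tendsto[OF g] by blast
  obtain c where c: "((\<lambda>X. ipX X (\<lambda>x. f x + g x) (\<lambda>x. f x + g x)) \<longlongrightarrow> c) (finite_subsets_at_top S)"
    using ipX_diag_tendsto[OF fg] by blast
  have "((\<lambda>X. (ipX X (\<lambda>x. f x + g x) (\<lambda>x. f x + g x) - ipX X f f - ipX X g g) / 2)
      \<longlongrightarrow> (c - a - b) / 2) (finite_subsets_at_top S)"
    by (intro tendsto_intros a b c) auto
  moreover have "\<forall>\<^sub>F X in finite_subsets_at_top S.
      (ipX X (\<lambda>x. f x + g x) (\<lambda>x. f x + g x) - ipX X f f - ipX X g g) / 2 = ipX X f g"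
  proof (rule eventually_finite_subsets_at_top_weakI)
    fix X assume X: "finite X" "X \<subseteq> S"
    have "ipX X (\<lambda>x. f x + g x) (\<lambda>x. f x + g x) =
        ipX X f (\<lambda>x. f x + g x) + ipX X g (\<lambda>x. f x + g x)"
      by (rule ipX_add[OF f g fg X])
    also have "ipX X f (\<lambda>x. f x + g x) = ipX X f f + ipX X f g"
      by (simp add: ipX_sym[OF f fg X] ipX_add[OF f g f X] ipX_sym[OF g f X])
    also have "ipX X g (\<lambda>x. f x + g x) = ipX X f g + ipX X g g"
      by (simp add: ipX_sym[OF g fg X] ipX_add[OF f g g X])
    finally show "(ipX X (\<lambda>x. f x + g x) (\<lambda>x. f x + g x) - ipX X f f - ipX X g g) / 2 = ipX X f g"
      by simp
  qed
  ultimately have "((\<lambda>X. ipX X f g) \<longlongrightarrow> (c - a - b) / 2) (finite_subsets_at_top S)"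
    by (rule Lim_transform_eventually)
  then show ?thesis
    unfolding ip_def using tendsto_Lim[OF finite_subsets_at_top_neq_bot] by metis
qed

section \<open>Properties of the limit inner product\<close>

lemma ip_eqI:
  assumes "f \<in> maH" "g \<in> maH" "(F \<longlongrightarrow> l) (finite_subsets_at_top S)"
    and "\<And>X. finite X \<Longrightarrow> X \<subseteq> S \<Longrightarrow> ipX X f g = F X"
  shows "ip f g = l"
proof (rule tendsto_unique[OF finite_subsets_at_top_neq_bot ip_tendsto[OF assms(1,2)]])
  have "\<forall>\<^sub>F X in finite_subsets_at_top S. F X = ipX X f g"
    using assms(4) by (intro eventually_finite_subsets_at_top_weakI) simp
  then show "((\<lambda>X. ipX X f g) \<longlongrightarrow> l) (finite_subsets_at_top S)"
    by (rule Lim_transform_eventually[OF assms(3)])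
qed

lemma ip_le:
  assumes "f \<in> maH" "\<And>X. finite X \<Longrightarrow> X \<subseteq> S \<Longrightarrow> ipX X f f \<le> B"
  shows "ip f f \<le> B"
  using assms
  by (intro tendsto_upperbound[OF ip_tendsto] eventually_finite_subsets_at_top_weakI) auto

lemma ipX_le_ip:
  assumes f: "f \<in> maH" and X: "finite X" "X \<subseteq> S"
  shows "ipX X f f \<le> ip f f"
proof (rule tendsto_lowerbound[OF ip_tendsto[OF f f]])
  show "\<forall>\<^sub>F Z in finite_subsets_at_top S. ipX X f f \<le> ipX Z f f"
    unfolding eventually_finite_subsets_at_top
    using X ipX_mono[OF f] by (intro exI[of _ X]) auto
qed simp

text \<open>\<open>ip f f\<close> serves as one constant for all finite sets at once; singletons
  turn this into the pointwise bound \<open>square_le_ip\<close>.\<close>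

lemma kbounded_ip:
  assumes f: "f \<in> maH" and X: "finite X" "X \<subseteq> S"
  shows "(\<Sum>x\<in>X. w x * f x)\<^sup>2 \<le> ip f f * kform K X w w"
proof -
  have "(\<Sum>x\<in>X. w x * f x)\<^sup>2 \<le> ipX X f f * kform K X w w"
    using kbounded_represents[OF X represents_weights[OF f X]]
    by (simp add: kbounded_def ipX_def)
  also have "\<dots> \<le> ip f f * kform K X w w"
    by (intro mult_right_mono ipX_le_ip nonneg f X)
  finally show ?thesis .
qed

lemma square_le_ip:
  assumes "f \<in> maH" "x \<in> S"
  shows "(f x)\<^sup>2 \<le> ip f f * K x x"
  using kbounded_ip[OF assms(1), of "{x}" "\<lambda>_. 1"] assms(2) by (simp add: kform_def)

lemma kernel_in_maH:
  assumes "x \<in> S"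
  shows "(\<lambda>y. if y \<in> S then K y x else 0) \<in> maH"
proof (rule maHI)
  fix X w assume X: "finite X" "X \<subseteq> S"
  have "(\<Sum>y\<in>X. w y * (if y \<in> S then K y x else 0)) = (\<Sum>y\<in>X. w y * K y x)"
    using X by (intro sum.cong) auto
  then show "(\<Sum>y\<in>X. w y * (if y \<in> S then K y x else 0))\<^sup>2 \<le> K x x * kform K X w w"
    using kbounded_kernel[OF X assms] by (simp add: kbounded_def)
qed simp

text \<open>As soon as \<open>X\<close> contains \<open>x\<close>, the section at \<open>x\<close>
  is represented by the unit weight at \<open>x\<close>, so the net is eventually constant.\<close>

lemma ip_kernel:
  assumes f: "f \<in> maH" and x: "x \<in> S"
  shows "ip f (\<lambda>y. if y \<in> S then K y x else 0) = f x"
proof (rule tendsto_unique[OF finite_subsets_at_top_neq_bot ip_tendsto[OF f kernel_in_maH[OF x]]])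
  let ?k = "\<lambda>y. if y \<in> S then K y x else 0"
  have "\<forall>\<^sub>F X in finite_subsets_at_top S. f x = ipX X f ?k"
    unfolding eventually_finite_subsets_at_top
  proof (intro exI[of _ "{x}"] conjI allI impI)
    fix X assume "finite X \<and> {x} \<subseteq> X \<and> X \<subseteq> S"
    then have X: "finite X" "X \<subseteq> S" "x \<in> X" by auto
    have "represents K X (\<lambda>y. if y \<in> {x} then 1 else 0) ?k"
      unfolding represents_def
      by (subst sum_zero_extend) (use X in \<open>auto\<close>)
    then have "ipX X ?k f = (\<Sum>y\<in>X. (if y \<in> {x} then 1 else 0) * f y)"
      by (rule ipX_eq[OF kernel_in_maH[OF x] f X(1,2)])
    also have "\<dots> = f x" by (subst sum_zero_extend) (use X in auto)
    finally show "f x = ipX X f ?k" using ipX_sym[OF f kernel_in_maH[OF x] X(1,2)] by simp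
  qed (use x in auto)
  then show "((\<lambda>X. ipX X f ?k) \<longlongrightarrow> f x) (finite_subsets_at_top S)"
    by (rule Lim_transform_eventually[OF tendsto_const])
qed

text \<open>Boundedness of point evaluations gives a pointwise limit \<open>f\<close>. Norm bounds
  survive the passage from \<open>F n\<close> to \<open>f\<close> because each is equivalent to a
  family of inequalities between finite sums, and these are closed under pointwise limits; the limit
  over finite sets is never interchanged with the limit over \<open>n\<close>.\<close>

lemma maH_complete:
  fixes F :: "nat \<Rightarrow> 'a \<Rightarrow> real"
  assumes F: "\<And>n. F n \<in> maH"
    and C: "\<forall>e>0. \<exists>N. \<forall>m\<ge>N. \<forall>n\<ge>N.
           sqrt (ip (\<lambda>x. F m x - F n x) (\<lambda>x. F m x - F n x)) < e"
  shows "\<exists>f\<in>maH. (\<lambda>n. sqrt (ip (\<lambda>x. F n x - f x) (\<lambda>x. F n x - f x))) \<longlonglongrightarrow> 0"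
proof -
  let ?d = "\<lambda>m n x. F m x - F n x"
  have d: "?d m n \<in> maH" for m n using F by (intro maH_diff)
  have C': "\<exists>N. \<forall>m\<ge>N. \<forall>n\<ge>N. ip (?d m n) (?d m n) < e\<^sup>2" if e: "e > 0" for e
  proof -
    obtain N where N: "\<And>m n. m \<ge> N \<Longrightarrow> n \<ge> N \<Longrightarrow> sqrt (ip (?d m n) (?d m n)) < e"
      using C e by blast
    have "ip (?d m n) (?d m n) < e\<^sup>2" if "m \<ge> N" "n \<ge> N" for m n
      using real_sqrt_less_iff[of "ip (?d m n) (?d m n)" "e\<^sup>2"] N[OF that] e by simp
    then show ?thesis by blast
  qed
  have conv: "\<exists>l. (\<lambda>n. F n x) \<longlonglongrightarrow> l" for x
  proof (cases "x \<in> S")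
    case False
    then show ?thesis using maH_zero[OF F] by (intro exI[of _ 0]) simp
  next
    case x: True
    have "0 \<le> K x x" using nonneg[of "{x}" "\<lambda>_. 1"] x by (simp add: kform_def)
    have "Cauchy (\<lambda>n. F n x)"
    proof (rule CauchyI)
      fix e :: real assume e: "e > 0"
      \<comment> \<open>Scaled so that \<open>e'\<close> squared times \<open>K x x + 1\<close> is
        \<open>e\<close> squared; the added 1 covers \<open>K x x = 0\<close>.\<close>
      define e' where "e' = e / sqrt (K x x + 1)"
      have e': "e' > 0" using e \<open>0 \<le> K x x\<close> by (simp add: e'_def)
      obtain N where N: "\<And>m n. m \<ge> N \<Longrightarrow> n \<ge> N \<Longrightarrow> ip (?d m n) (?d m n) < e'\<^sup>2"
        using C'[OF e'] by blast
      have "norm (F m x - F n x) < e" if mn: "m \<ge> N" "n \<ge> N" for m n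
      proof -
        have "(F m x - F n x)\<^sup>2 \<le> ip (?d m n) (?d m n) * K x x"
          by (rule square_le_ip[OF d x])
        also have "\<dots> \<le> e'\<^sup>2 * K x x"
          using N[OF mn] \<open>0 \<le> K x x\<close> by (intro mult_right_mono) auto
        also have "\<dots> < e'\<^sup>2 * (K x x + 1)" using e' by simp
        also have "\<dots> = e\<^sup>2" using \<open>0 \<le> K x x\<close> by (simp add: e'_def power_divide)
        finally have "\<bar>F m x - F n x\<bar>\<^sup>2 < e\<^sup>2" by simp
        then have "\<bar>F m x - F n x\<bar> < e"
          by (rule power2_less_imp_less) (use e in simp)
        then show ?thesis by simp
      qed
      then show "\<exists>M. \<forall>m\<ge>M. \<forall>n\<ge>M. norm (F m x - F n x) < e" by blast
    qed
    then show ?thesis using Cauchy_convergent_iff convergent_def by blast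
  qed
  define f where "f = (\<lambda>x. lim (\<lambda>n. F n x))"
  have f: "(\<lambda>n. F n x) \<longlonglongrightarrow> f x" for x
    using conv[of x] by (auto simp: f_def convergent_def convergent_LIMSEQ_iff[symmetric])
  have fS: "f x = 0" if "x \<notin> S" for x
    using f[of x] maH_zero[OF F that] by (simp add: LIMSEQ_const_iff)
  have diff: "(\<lambda>x. F m x - f x) \<in> maH \<and> ip (\<lambda>x. F m x - f x) (\<lambda>x. F m x - f x) \<le> e\<^sup>2"
    if N: "\<And>m n. m \<ge> N \<Longrightarrow> n \<ge> N \<Longrightarrow> ip (?d m n) (?d m n) < e\<^sup>2" and m: "m \<ge> N" for m N e
  proof -
    have b: "(\<Sum>x\<in>X. w x * (F m x - f x))\<^sup>2 \<le> e\<^sup>2 * kform K X w w" if X: "finite X" "X \<subseteq> S" for X w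
    proof (rule LIMSEQ_le_const2)
      show "(\<lambda>n. (\<Sum>x\<in>X. w x * (F m x - F n x))\<^sup>2) \<longlonglongrightarrow> (\<Sum>x\<in>X. w x * (F m x - f x))\<^sup>2"
        by (intro tendsto_intros f)
      have "(\<Sum>x\<in>X. w x * (F m x - F n x))\<^sup>2 \<le> e\<^sup>2 * kform K X w w" if "n \<ge> N" for n
      proof -
        have "(\<Sum>x\<in>X. w x * (F m x - F n x))\<^sup>2 \<le> ip (?d m n) (?d m n) * kform K X w w"
          by (rule kbounded_ip[OF d X])
        also have "\<dots> \<le> e\<^sup>2 * kform K X w w"
          using N[OF m that] by (intro mult_right_mono nonneg X) simp
        finally show ?thesis .
      qed
      then show "\<exists>N. \<forall>n\<ge>N. (\<Sum>x\<in>X. w x * (F m x - F n x))\<^sup>2 \<le> e\<^sup>2 * kform K X w w" by blast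
    qed
    have H: "(\<lambda>x. F m x - f x) \<in> maH"
      by (rule maHI[OF _ b]) (simp_all add: fS maH_zero[OF F])
    moreover have "ip (\<lambda>x. F m x - f x) (\<lambda>x. F m x - f x) \<le> e\<^sup>2"
      by (intro ip_le[OF H] ipX_le[OF H]) (simp_all add: kbounded_def b)
    ultimately show ?thesis by blast
  qed
  obtain N1 where "\<And>m n. m \<ge> N1 \<Longrightarrow> n \<ge> N1 \<Longrightarrow> ip (?d m n) (?d m n) < 1\<^sup>2"
    using C'[of 1] by auto
  then have "(\<lambda>x. F N1 x - f x) \<in> maH" using diff[of N1 1 N1] by blast
  then have fH: "f \<in> maH" using maH_diff[OF F[of N1]] by force
  have "(\<lambda>n. sqrt (ip (\<lambda>x. F n x - f x) (\<lambda>x. F n x - f x))) \<longlonglongrightarrow> 0"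
  proof (rule LIMSEQ_I)
    fix r :: real assume r: "r > 0"
    \<comment> \<open>The limit only keeps a weak inequality, so half of \<open>r\<close> is used to
      end with a strict one.\<close>
    obtain N where N: "\<And>m n. m \<ge> N \<Longrightarrow> n \<ge> N \<Longrightarrow> ip (?d m n) (?d m n) < (r / 2)\<^sup>2"
      using C'[of "r / 2"] r by auto
    have "norm (sqrt (ip (\<lambda>x. F n x - f x) (\<lambda>x. F n x - f x)) - 0) < r" if n: "n \<ge> N" for n
    proof -
      have g: "(\<lambda>x. F n x - f x) \<in> maH" and
        "ip (\<lambda>x. F n x - f x) (\<lambda>x. F n x - f x) \<le> (r / 2)\<^sup>2"
        using diff[OF N n] by auto
      moreover have "0 \<le> ip (\<lambda>x. F n x - f x) (\<lambda>x. F n x - f x)"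
        by (rule tendsto_lowerbound[OF ip_tendsto[OF g g]])
           (auto intro!: eventually_finite_subsets_at_top_weakI ipX_nonneg g)
      ultimately have "sqrt (ip (\<lambda>x. F n x - f x) (\<lambda>x. F n x - f x)) \<le> r / 2"
        using real_sqrt_le_mono[of _ "(r / 2)\<^sup>2"] r by fastforce
      then show ?thesis using r \<open>0 \<le> ip (\<lambda>x. F n x - f x) (\<lambda>x. F n x - f x)\<close> by simp
    qed
    then show "\<exists>no. \<forall>n\<ge>no. norm (sqrt (ip (\<lambda>x. F n x - f x) (\<lambda>x. F n x - f x)) - 0) < r"
      by blast
  qed
  with fH show ?thesis by blast
qed

theorem moore_aronszajn: "is_rkhs S K maH ip"
proof -
  have zero: "(\<lambda>_. 0) \<in> maH" by (rule maHI[where B = 0]) auto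
  have pos: "0 \<le> ip f f" if f: "f \<in> maH" for f
    by (rule tendsto_lowerbound[OF ip_tendsto[OF f f]])
       (auto intro!: eventually_finite_subsets_at_top_weakI ipX_nonneg f)
  have def: "f = (\<lambda>_. 0)" if f: "f \<in> maH" and "ip f f = 0" for f
  proof
    fix x
    show "f x = 0"
      using square_le_ip[OF f, of x] maH_zero[OF f, of x] that(2) by (cases "x \<in> S") auto
  qed
  have ip_sym: "ip f g = ip g f" if "f \<in> maH" "g \<in> maH" for f g
    by (rule ip_eqI[OF that ip_tendsto[OF that(2,1)]]) (rule ipX_sym[OF that])
  have ip_add: "ip (\<lambda>x. f x + g x) h = ip f h + ip g h"
    if "f \<in> maH" "g \<in> maH" "h \<in> maH" for f g h
    by (rule ip_eqI[OF maH_add[OF that(1,2)] that(3) tendsto_add[OF ip_tendsto ip_tendsto]])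
      (simp_all add: that ipX_add)
  have ip_scale: "ip (\<lambda>x. c * f x) g = c * ip f g" if "f \<in> maH" "g \<in> maH" for c f g
    by (rule ip_eqI[OF maH_scale[OF that(1)] that(2) tendsto_mult[OF tendsto_const ip_tendsto]])
      (simp_all add: that ipX_scale)
  have "function_hilbert_space S maH ip"
    unfolding function_hilbert_space_def
    by (intro conjI ballI allI impI; (elim conjE)?; (rule ip_sym; assumption)?)
      (simp_all add: zero pos maH_zero maH_add maH_scale ip_add ip_scale def maH_complete)
  then show ?thesis
    unfolding is_rkhs_def using kernel_in_maH ip_kernel by blast
qed

end

section \<open>Reproducing kernel Hilbert spaces\<close>

text \<open>Everything here follows from \<open>is_rkhs\<close> alone and therefore applies to
  whichever space the choice in \<open>rkhs\<close> returns.\<close>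

locale rkhs_space =
  fixes S :: "'a set" and K :: "'a \<Rightarrow> 'a \<Rightarrow> real"
    and H :: "('a \<Rightarrow> real) set" and ip :: "('a \<Rightarrow> real) \<Rightarrow> ('a \<Rightarrow> real) \<Rightarrow> real"
  assumes rkhs: "is_rkhs S K H ip"
begin

definition nrm :: "('a \<Rightarrow> real) \<Rightarrow> real" where
  "nrm f = sqrt (ip f f)"

definition section_at :: "'a \<Rightarrow> 'a \<Rightarrow> real" where
  "section_at x = (\<lambda>y. if y \<in> S then K y x else 0)"

lemma H_facts:
  shows H_outside: "\<And>f x. f \<in> H \<Longrightarrow> x \<notin> S \<Longrightarrow> f x = 0"
    and H_zero: "(\<lambda>_. 0) \<in> H"
    and H_add: "\<And>f g. f \<in> H \<Longrightarrow> g \<in> H \<Longrightarrow> (\<lambda>x. f x + g x) \<in> H"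
    and H_scale: "\<And>f c. f \<in> H \<Longrightarrow> (\<lambda>x. c * f x) \<in> H"
    and ip_sym: "\<And>f g. f \<in> H \<Longrightarrow> g \<in> H \<Longrightarrow> ip f g = ip g f"
    and ip_add: "\<And>f g h. f \<in> H \<Longrightarrow> g \<in> H \<Longrightarrow> h \<in> H \<Longrightarrow> ip (\<lambda>x. f x + g x) h = ip f h + ip g h"
    and ip_scale: "\<And>f g c. f \<in> H \<Longrightarrow> g \<in> H \<Longrightarrow> ip (\<lambda>x. c * f x) g = c * ip f g"
    and ip_pos: "\<And>f. f \<in> H \<Longrightarrow> 0 \<le> ip f f"
  using rkhs[unfolded is_rkhs_def function_hilbert_space_def, THEN conjunct1]
  by (elim conjE; simp)+

lemma H_complete:
  assumes "\<And>n. F n \<in> H"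
    and "\<And>e. e > 0 \<Longrightarrow> \<exists>N. \<forall>m\<ge>N. \<forall>n\<ge>N. nrm (\<lambda>x. F m x - F n x) < e"
  shows "\<exists>f\<in>H. (\<lambda>n. nrm (\<lambda>x. F n x - f x)) \<longlonglongrightarrow> 0"
proof -
  have "\<forall>F::nat \<Rightarrow> 'a \<Rightarrow> real. (\<forall>n. F n \<in> H) \<and>
        (\<forall>e>0. \<exists>N. \<forall>m\<ge>N. \<forall>n\<ge>N.
           sqrt (ip (\<lambda>x. F m x - F n x) (\<lambda>x. F m x - F n x)) < e) \<longrightarrow>
        (\<exists>f\<in>H. (\<lambda>n. sqrt (ip (\<lambda>x. F n x - f x) (\<lambda>x. F n x - f x))) \<longlonglongrightarrow> 0)"
    using rkhs unfolding is_rkhs_def function_hilbert_space_def by (elim conjE)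
  from this[rule_format, of F] show ?thesis
    using assms unfolding nrm_def by blast
qed

lemma section_in_H: "x \<in> S \<Longrightarrow> section_at x \<in> H"
  using rkhs by (simp add: is_rkhs_def section_at_def)

lemma ip_section: "x \<in> S \<Longrightarrow> f \<in> H \<Longrightarrow> ip f (section_at x) = f x"
  using rkhs by (simp add: is_rkhs_def section_at_def)

lemma H_diff: "f \<in> H \<Longrightarrow> g \<in> H \<Longrightarrow> (\<lambda>x. f x - g x) \<in> H"
  using H_add[of f "\<lambda>x. - 1 * g x"] H_scale[of g "- 1"] by simp

lemma ip_diff:
  assumes "f \<in> H" "g \<in> H" "h \<in> H"
  shows "ip (\<lambda>x. f x - g x) h = ip f h - ip g h"
  using ip_add[OF assms(1) H_scale[OF assms(2), of "- 1"] assms(3)]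
    ip_scale[OF assms(2,3), of "- 1"] by simp

lemma ip_zero: "f \<in> H \<Longrightarrow> ip (\<lambda>_. 0) f = 0"
  using ip_scale[of f f 0] by simp

lemma H_sum:
  assumes "\<And>y. y \<in> X \<Longrightarrow> F y \<in> H"
  shows "(\<lambda>x. \<Sum>y\<in>X. w y * F y x) \<in> H"
  using assms by (induction X rule: infinite_finite_induct) (simp_all add: H_zero H_add H_scale)

lemma ip_sum:
  assumes "\<And>y. y \<in> X \<Longrightarrow> F y \<in> H" "g \<in> H"
  shows "ip (\<lambda>x. \<Sum>y\<in>X. w y * F y x) g = (\<Sum>y\<in>X. w y * ip (F y) g)"
  using assms
proof (induction X rule: infinite_finite_induct)
  case (insert z X)
  have "ip (\<lambda>x. w z * F z x + (\<Sum>y\<in>X. w y * F y x)) g =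
      w z * ip (F z) g + ip (\<lambda>x. \<Sum>y\<in>X. w y * F y x) g"
    using insert.prems by (subst ip_add) (simp_all add: ip_scale H_scale H_sum)
  then show ?case using insert by simp
qed (simp_all add: ip_zero)

lemma nrm_ge_0: "f \<in> H \<Longrightarrow> 0 \<le> nrm f"
  using ip_pos by (simp add: nrm_def)

lemma nrm_square: "f \<in> H \<Longrightarrow> (nrm f)\<^sup>2 = ip f f"
  using ip_pos by (simp add: nrm_def)

lemma nrm_scale:
  assumes "f \<in> H"
  shows "nrm (\<lambda>x. c * f x) = \<bar>c\<bar> * nrm f"
proof -
  have "ip (\<lambda>x. c * f x) (\<lambda>x. c * f x) = c\<^sup>2 * ip f f"
    using assms by (simp add: ip_scale H_scale ip_sym[of f "\<lambda>x. c * f x"] power2_eq_square)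
  then show ?thesis by (simp add: nrm_def real_sqrt_mult)
qed

lemma cauchy_schwarz:
  assumes f: "f \<in> H" and g: "g \<in> H"
  shows "\<bar>ip f g\<bar> \<le> nrm f * nrm g"
proof -
  have "(ip f g)\<^sup>2 \<le> ip f f * ip g g"
  proof (rule discriminant_bound)
    fix t
    have tg: "(\<lambda>x. t * g x) \<in> H" and h: "(\<lambda>x. f x + t * g x) \<in> H"
      using f g by (auto intro: H_add H_scale)
    have *: "ip (\<lambda>x. f x + t * g x) k = ip f k + t * ip g k" if "k \<in> H" for k
      using f g tg that by (simp add: ip_add ip_scale)
    have "ip (\<lambda>x. f x + t * g x) (\<lambda>x. f x + t * g x) = ip f f + 2 * t * ip f g + t\<^sup>2 * ip g g"
      unfolding *[OF h] ip_sym[OF f h] ip_sym[OF g h] *[OF f] *[OF g] ip_sym[OF g f]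
      by (simp add: power2_eq_square algebra_simps)
    then show "0 \<le> ip f f + 2 * t * ip f g + t\<^sup>2 * ip g g"
      using ip_pos[OF h] by simp
  qed (use g ip_pos in blast)
  also have "\<dots> = (nrm f * nrm g)\<^sup>2" using f g by (simp add: power_mult_distrib nrm_square)
  finally show ?thesis
    using nrm_ge_0[OF f] nrm_ge_0[OF g] by (simp add: abs_le_square_iff[symmetric] abs_mult)
qed

lemma kernel_eq: "x \<in> S \<Longrightarrow> y \<in> S \<Longrightarrow> ip (section_at y) (section_at x) = K x y"
  using ip_section[of x "section_at y"] section_in_H[of y] by (simp add: section_at_def)

lemma kernel_sym: "x \<in> S \<Longrightarrow> y \<in> S \<Longrightarrow> K x y = K y x"
  using kernel_eq ip_sym section_in_H by metis

lemma abs_eval_le: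
  assumes "f \<in> H" "x \<in> S"
  shows "\<bar>f x\<bar> \<le> nrm f * sqrt (K x x)"
  using cauchy_schwarz[OF assms(1) section_in_H[OF assms(2)]] assms
  by (simp add: ip_section) (simp add: nrm_def kernel_eq)

text \<open>The difference of two evaluations is represented by the difference of two sections, and
  the root is the norm of that difference. This is the source of continuity, hence of
  measurability.\<close>

lemma eval_diff_le:
  assumes f: "f \<in> H" and x: "x \<in> S" and y: "y \<in> S"
  shows "\<bar>f x - f y\<bar> \<le> nrm f * sqrt (K x x - 2 * K x y + K y y)"
proof -
  let ?h = "\<lambda>z. section_at x z - section_at y z"
  note sx = section_in_H[OF x] and sy = section_in_H[OF y]
  have h: "?h \<in> H" by (rule H_diff[OF sx sy])
  have "ip f ?h = f x - f y"
    using f h by (simp add: ip_sym[OF f h] ip_diff[OF sx sy f] ip_sym[OF sx f] ip_sym[OF sy f]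
        ip_section x y)
  moreover have "ip ?h ?h = K x x - 2 * K x y + K y y"
    unfolding ip_diff[OF sx sy h] ip_sym[OF sx h] ip_sym[OF sy h] ip_diff[OF sx sy sx]
      ip_diff[OF sx sy sy]
    using x y by (simp add: kernel_eq kernel_sym)
  ultimately show ?thesis using cauchy_schwarz[OF f h] by (simp add: nrm_def)
qed

text \<open>\<open>S\<close> need not be a topological space of its own: \<open>\<phi>\<close> pulls
  \<open>f\<close> back to one. In dimension \<open>d\<close> it is the restriction map from all
  functions on the naturals; in dimension one it is the identity.\<close>

lemma isCont_compose:
  fixes \<phi> :: "'b::t2_space \<Rightarrow> 'a"
  assumes f: "f \<in> H" and \<phi>: "\<And>y. \<phi> y \<in> S"
    and lim: "((\<lambda>y. K (\<phi> y) (\<phi> y) - 2 * K (\<phi> y) (\<phi> x) + K (\<phi> x) (\<phi> x)) \<longlongrightarrow> 0) (at x)"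
  shows "isCont (\<lambda>y. f (\<phi> y)) x"
proof -
  have "((\<lambda>y. nrm f * sqrt (K (\<phi> y) (\<phi> y) - 2 * K (\<phi> y) (\<phi> x) + K (\<phi> x) (\<phi> x))) \<longlongrightarrow> nrm f * sqrt 0) (at x)"
    by (intro tendsto_intros lim)
  then have "((\<lambda>y. f (\<phi> y) - f (\<phi> x)) \<longlongrightarrow> 0) (at x)"
    by (intro Lim_null_comparison[of "\<lambda>y. f (\<phi> y) - f (\<phi> x)"] always_eventually)
       (auto intro: eval_diff_le[OF f \<phi> \<phi>])
  then show ?thesis by (simp add: isCont_def LIM_zero_iff)
qed

text \<open>The representer is the minimiser of \<open>J\<close>, which boundedness of
  \<open>L\<close> keeps bounded below. An approximate minimiser satisfies the stationarity equation
  \<open>ip f g = L g\<close> approximately (\<open>key\<close>), because a quadratic in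
  \<open>t\<close> that is almost minimal at 0 has a small linear coefficient. This makes the
  minimising sequence Cauchy, and the equation is exact in the limit.\<close>

lemma riesz:
  assumes L_add: "\<And>f g. f \<in> H \<Longrightarrow> g \<in> H \<Longrightarrow> L (\<lambda>x. f x + g x) = L f + L g"
    and L_scale: "\<And>f c. f \<in> H \<Longrightarrow> L (\<lambda>x. c * f x) = c * L f"
    and L_bound: "\<And>f. f \<in> H \<Longrightarrow> \<bar>L f\<bar> \<le> B * nrm f"
  shows "\<exists>\<mu>\<in>H. \<forall>f\<in>H. ip f \<mu> = L f"
proof -
  define J where "J f = ip f f / 2 - L f" for f
  define m where "m = (INF f\<in>H. J f)"
  have lower: "- B\<^sup>2 / 2 \<le> J f" if "f \<in> H" for f
  proof -
    have "0 \<le> (nrm f - B)\<^sup>2" by simp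
    then show ?thesis
      using L_bound[OF that] nrm_square[OF that]
      by (simp add: J_def power2_eq_square algebra_simps)
  qed
  have m_le: "m \<le> J f" if "f \<in> H" for f
    unfolding m_def using that lower by (intro cINF_lower bdd_belowI2[where m = "- B\<^sup>2 / 2"]) auto
  have "\<exists>f\<in>H. J f < m + e" if "e > 0" for e
    using cInf_lessD[of "J ` H" "m + e"] H_zero that unfolding m_def by auto
  \<comment> \<open>The tolerance is chosen so that the square root of its double, which is the
    defect that \<open>key\<close> obtains per unit of \<open>nrm g\<close>, is
    \<open>1 / (real n + 1)\<close>.\<close>
  then have "\<exists>f\<in>H. J f < m + 1 / (2 * (real n + 1)\<^sup>2)" for n
    by (simp add: zero_less_power2 add_nonneg_eq_0_iff)
  then obtain F where F: "\<And>n. F n \<in> H" and JF: "\<And>n. J (F n) < m + 1 / (2 * (real n + 1)\<^sup>2)"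
    by metis
  have key: "\<bar>ip (F n) g - L g\<bar> \<le> nrm g / (real n + 1)" if g: "g \<in> H" for n g
  proof -
    let ?f = "F n" let ?d = "1 / (2 * (real n + 1)\<^sup>2)"
    note f = F[of n]
    have "((ip ?f g - L g) / 2)\<^sup>2 \<le> ?d * (ip g g / 2)"
    proof (rule discriminant_bound)
      fix t
      have tg: "(\<lambda>x. t * g x) \<in> H" and h: "(\<lambda>x. ?f x + t * g x) \<in> H"
        using f g by (auto intro: H_add H_scale)
      have *: "ip (\<lambda>x. ?f x + t * g x) k = ip ?f k + t * ip g k" if "k \<in> H" for k
        using f g tg that by (simp add: ip_add ip_scale)
      have "ip (\<lambda>x. ?f x + t * g x) (\<lambda>x. ?f x + t * g x) = ip ?f ?f + 2 * t * ip ?f g + t\<^sup>2 * ip g g"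
        unfolding *[OF h] ip_sym[OF f h] ip_sym[OF g h] *[OF f] *[OF g] ip_sym[OF g f]
        by (simp add: power2_eq_square algebra_simps)
      moreover have "L (\<lambda>x. ?f x + t * g x) = L ?f + t * L g"
        using f g tg by (simp add: L_add L_scale)
      moreover have "J ?f < J (\<lambda>x. ?f x + t * g x) + ?d"
        using JF[of n] m_le[OF h] by linarith
      ultimately show "0 \<le> ?d + 2 * t * ((ip ?f g - L g) / 2) + t\<^sup>2 * (ip g g / 2)"
        unfolding J_def by (simp add: algebra_simps add_divide_distrib diff_divide_distrib)
    qed (use g ip_pos in simp)
    also have "\<dots> = (nrm g / (2 * (real n + 1)))\<^sup>2"
      using g by (simp add: power_divide nrm_square) (simp add: power2_eq_square algebra_simps)
    finally have "\<bar>(ip ?f g - L g) / 2\<bar> \<le> \<bar>nrm g / (2 * (real n + 1))\<bar>"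
      unfolding abs_le_square_iff .
    then show ?thesis using nrm_ge_0[OF g] by (simp add: abs_divide field_simps)
  qed
  have cauchy: "nrm (\<lambda>x. F i x - F j x) \<le> 1 / (real i + 1) + 1 / (real j + 1)" for i j
  proof -
    let ?g = "\<lambda>x. F i x - F j x"
    have g: "?g \<in> H" using F by (intro H_diff)
    \<comment> \<open>Taking the difference itself as the test function lets the two terms
      \<open>L ?g\<close> cancel.\<close>
    have "(nrm ?g)\<^sup>2 = (ip (F i) ?g - L ?g) - (ip (F j) ?g - L ?g)"
      using nrm_square[OF g] ip_diff[OF F F g] by simp
    also have "\<dots> \<le> nrm ?g / (real i + 1) + nrm ?g / (real j + 1)"
      using key[OF g, of i] key[OF g, of j] by linarith
    finally have "nrm ?g * nrm ?g \<le> nrm ?g * (1 / (real i + 1) + 1 / (real j + 1))"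
      by (simp add: power2_eq_square algebra_simps)
    moreover have "0 \<le> 1 / (real i + 1) + 1 / (real j + 1)" by simp
    ultimately show ?thesis
      using nrm_ge_0[OF g] by (cases "nrm ?g = 0") auto
  qed
  have inv0: "(\<lambda>n. 1 / (real n + 1)) \<longlonglongrightarrow> 0"
    using LIMSEQ_inverse_real_of_nat by (simp add: inverse_eq_divide add.commute)
  have "\<exists>N. \<forall>i\<ge>N. \<forall>j\<ge>N. nrm (\<lambda>x. F i x - F j x) < e" if "e > 0" for e
  proof -
    obtain N where N: "\<And>n. n \<ge> N \<Longrightarrow> 1 / (real n + 1) < e / 2"
      using order_tendstoD(2)[OF inv0, of "e / 2"] \<open>e > 0\<close> by (auto simp: eventually_sequentially)
    have "nrm (\<lambda>x. F i x - F j x) < e" if "i \<ge> N" "j \<ge> N" for i j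
      using cauchy[of i j] N[OF that(1)] N[OF that(2)] by linarith
    then show ?thesis by blast
  qed
  then have "\<exists>f\<in>H. (\<lambda>n. nrm (\<lambda>x. F n x - f x)) \<longlonglongrightarrow> 0"
    by (rule H_complete[OF F])
  then obtain \<mu> where \<mu>: "\<mu> \<in> H" "(\<lambda>n. nrm (\<lambda>x. F n x - \<mu> x)) \<longlonglongrightarrow> 0"
    by blast
  have "ip g \<mu> = L g" if g: "g \<in> H" for g
  proof -
    have "\<bar>ip \<mu> g - L g\<bar> \<le> nrm (\<lambda>x. F n x - \<mu> x) * nrm g + 1 / (real n + 1) * nrm g" for n
    proof -
      have "\<bar>ip (F n) g - ip \<mu> g\<bar> \<le> nrm (\<lambda>x. F n x - \<mu> x) * nrm g"
        using cauchy_schwarz[OF H_diff[OF F \<mu>(1)] g, of n] ip_diff[OF F \<mu>(1) g, of n] by simp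
      then show ?thesis using key[OF g, of n] by simp
    qed
    moreover have "(\<lambda>n. nrm (\<lambda>x. F n x - \<mu> x) * nrm g + 1 / (real n + 1) * nrm g) \<longlonglongrightarrow> 0 * nrm g + 0 * nrm g"
      by (intro tendsto_intros \<mu>(2) inv0)
    ultimately have "\<bar>ip \<mu> g - L g\<bar> \<le> 0 * nrm g + 0 * nrm g"
      by (intro LIMSEQ_le_const[of _ _ "\<bar>ip \<mu> g - L g\<bar>"]) auto
    then show ?thesis using ip_sym[OF g \<mu>(1)] by simp
  qed
  then show ?thesis using \<mu>(1) by blast
qed

definition combination :: "'a set \<Rightarrow> ('a \<Rightarrow> real) \<Rightarrow> 'a \<Rightarrow> real" where
  "combination X w = (\<lambda>x. \<Sum>y\<in>X. w y * section_at y x)"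

lemma combination_in_H: "X \<subseteq> S \<Longrightarrow> combination X w \<in> H"
  unfolding combination_def by (intro H_sum section_in_H) blast

lemma ip_combination:
  assumes "X \<subseteq> S" "f \<in> H"
  shows "ip f (combination X w) = (\<Sum>x\<in>X. w x * f x)"
proof -
  have "ip f (combination X w) = ip (combination X w) f"
    using assms combination_in_H by (intro ip_sym) auto
  also have "\<dots> = (\<Sum>x\<in>X. w x * ip (section_at x) f)"
    unfolding combination_def by (rule ip_sum) (use assms section_in_H in auto)
  also have "\<dots> = (\<Sum>x\<in>X. w x * f x)"
  proof (rule sum.cong)
    fix x assume "x \<in> X"
    then have "x \<in> S" using assms(1) by blast
    then show "w x * ip (section_at x) f = w x * f x"
      using ip_sym[OF section_in_H assms(2)] ip_section assms(2) by simp
  qed simp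
  finally show ?thesis .
qed

lemma combination_at: "X \<subseteq> S \<Longrightarrow> x \<in> S \<Longrightarrow> combination X w x = (\<Sum>y\<in>X. w y * K x y)"
  by (simp add: combination_def section_at_def)

lemma ip_combination_self:
  assumes "X \<subseteq> S"
  shows "ip (combination X w) (combination X w) = kform K X w w"
  unfolding ip_combination[OF assms combination_in_H[OF assms]] kform_def
  using assms combination_at[OF assms] by (intro sum.cong) auto

sublocale psd_kernel S K
proof
  show "0 \<le> kform K X w w" if "finite X" "X \<subseteq> S" for X w
    using ip_pos[OF combination_in_H[OF that(2), of w]] ip_combination_self[OF that(2)] by simp
qed (rule kernel_sym)

lemma interpolation:
  assumes X: "finite X" "X \<subseteq> S" and f: "f \<in> H"
  shows "\<exists>w. \<forall>x\<in>X. combination X w x = f x"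
proof -
  have "kbounded K X f (ip f f)"
    unfolding kbounded_def
  proof
    fix w
    have "\<bar>\<Sum>x\<in>X. w x * f x\<bar> \<le> nrm f * nrm (combination X w)"
      using cauchy_schwarz[OF f combination_in_H[OF X(2), of w]] ip_combination[OF X(2) f] by simp
    then have "\<bar>\<Sum>x\<in>X. w x * f x\<bar>\<^sup>2 \<le> (nrm f * nrm (combination X w))\<^sup>2"
      by (rule power_mono) simp
    then show "(\<Sum>x\<in>X. w x * f x)\<^sup>2 \<le> ip f f * kform K X w w"
      by (simp add: power_mult_distrib nrm_square f combination_in_H X ip_combination_self)
  qed
  then obtain w where "represents K X w f" using represents_exists[OF X] by blast
  then have "\<forall>x\<in>X. combination X w x = f x"
    using X combination_at[OF X(2)] by (auto simp: represents_def subset_iff)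
  then show ?thesis by blast
qed

end

section \<open>Bounded functionals, worst-case errors and optimal weights\<close>

locale rkhs_functional = rkhs_space +
  fixes L :: "('a \<Rightarrow> real) \<Rightarrow> real" and \<mu> :: "'a \<Rightarrow> real"
  assumes \<mu>_in_H: "\<mu> \<in> H" and ip_\<mu>: "f \<in> H \<Longrightarrow> ip f \<mu> = L f"
begin

definition wce :: "(('a \<Rightarrow> real) \<Rightarrow> real) \<Rightarrow> real" where
  "wce Q = (SUP f\<in>{f \<in> H. nrm f \<le> 1}. \<bar>L f - Q f\<bar>)"

definition residual :: "'a set \<Rightarrow> ('a \<Rightarrow> real) \<Rightarrow> 'a \<Rightarrow> real" where
  "residual X w = (\<lambda>x. \<mu> x - combination X w x)"

lemma residual_in_H: "X \<subseteq> S \<Longrightarrow> residual X w \<in> H"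
  unfolding residual_def by (intro H_diff \<mu>_in_H combination_in_H)

lemma ip_residual:
  assumes X: "X \<subseteq> S" and f: "f \<in> H"
  shows "ip f (residual X w) = L f - quad_rule X w f"
  using ip_diff[OF \<mu>_in_H combination_in_H[OF X] f]
    ip_sym[OF f residual_in_H[OF X]] ip_sym[OF f \<mu>_in_H] ip_sym[OF f combination_in_H[OF X]]
    ip_combination[OF X f] ip_\<mu>[OF f]
  by (simp add: residual_def quad_rule_def)

lemma residual_norm_square:
  assumes X: "X \<subseteq> S"
  shows "(nrm (residual X w))\<^sup>2 = L \<mu> - 2 * (\<Sum>x\<in>X. w x * \<mu> x) + kform K X w w"
proof -
  have "(nrm (residual X w))\<^sup>2 = ip \<mu> (residual X w) - ip (combination X w) (residual X w)"
    using nrm_square[OF residual_in_H[OF X, of w]]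
      ip_diff[OF \<mu>_in_H combination_in_H[OF X] residual_in_H[OF X, of w], of w]
    by (simp add: residual_def)
  also have "ip (combination X w) (residual X w) = (\<Sum>x\<in>X. w x * \<mu> x) - kform K X w w"
    using ip_residual[OF X combination_in_H[OF X]] ip_\<mu>[OF combination_in_H[OF X]]
      ip_sym[OF combination_in_H[OF X] \<mu>_in_H] ip_combination[OF X \<mu>_in_H]
      ip_combination[OF X combination_in_H[OF X]] ip_combination_self[OF X]
    by (simp add: quad_rule_def)
  also have "ip \<mu> (residual X w) = L \<mu> - (\<Sum>x\<in>X. w x * \<mu> x)"
    using ip_residual[OF X \<mu>_in_H] by (simp add: quad_rule_def)
  finally show ?thesis by simp
qed

lemma wce_quad_rule:
  assumes X: "X \<subseteq> S"
  shows "wce (quad_rule X w) = nrm (residual X w)"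
proof -
  let ?r = "residual X w"
  note r = residual_in_H[OF X, of w]
  have le: "\<bar>L f - quad_rule X w f\<bar> \<le> nrm ?r" if "f \<in> {f \<in> H. nrm f \<le> 1}" for f
  proof -
    have f: "f \<in> H" "nrm f \<le> 1" using that by auto
    have "\<bar>L f - quad_rule X w f\<bar> \<le> nrm f * nrm ?r"
      using cauchy_schwarz[OF f(1) r] ip_residual[OF X f(1)] by simp
    also have "\<dots> \<le> 1 * nrm ?r" using f(2) nrm_ge_0[OF r] by (intro mult_right_mono)
    finally show ?thesis by simp
  qed
  show ?thesis
  proof (rule antisym)
    have "(\<lambda>_. 0) \<in> {f \<in> H. nrm f \<le> 1}" by (simp add: H_zero nrm_def ip_zero)
    then show "wce (quad_rule X w) \<le> nrm ?r"
      unfolding wce_def using le by (intro cSUP_least) auto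
    have bdd: "bdd_above ((\<lambda>f. \<bar>L f - quad_rule X w f\<bar>) ` {f \<in> H. nrm f \<le> 1})"
      using le by (intro bdd_aboveI2)
    \<comment> \<open>The normalised residual attains the supremum. For a residual of norm 0,
      \<open>inverse 0 = 0\<close> makes it the zero function, which is still admissible.\<close>
    define f where "f = (\<lambda>x. inverse (nrm ?r) * ?r x)"
    have f: "f \<in> H" unfolding f_def by (intro H_scale r)
    have nf: "nrm f \<le> 1"
      unfolding f_def nrm_scale[OF r] using nrm_ge_0[OF r] by (cases "nrm ?r = 0") simp_all
    have "nrm ?r = \<bar>L f - quad_rule X w f\<bar>"
    proof -
      have "ip f ?r = inverse (nrm ?r) * (nrm ?r)\<^sup>2"
        unfolding f_def using ip_scale[OF r r] nrm_square[OF r] by simp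
      also have "\<dots> = nrm ?r" by (cases "nrm ?r = 0") (simp_all add: power2_eq_square)
      finally show ?thesis using ip_residual[OF X f] nrm_ge_0[OF r] by simp
    qed
    also have "\<dots> \<le> wce (quad_rule X w)"
      unfolding wce_def using f nf by (intro cSUP_upper bdd) auto
    finally show "nrm ?r \<le> wce (quad_rule X w)" .
  qed
qed

text \<open>Weights that interpolate \<open>\<mu>\<close> make the residual vanish on
  \<open>X\<close>. Its inner product with the residual of any other weights is then
  \<open>L ?r\<close>, whatever those weights are, and Cauchy-Schwarz turns this orthogonality into
  minimality.\<close>

lemma optimal_weights:
  assumes X: "finite X" "X \<subseteq> S"
  shows "\<exists>w. (\<forall>x\<in>X. residual X w x = 0) \<and> (\<forall>v. nrm (residual X w) \<le> nrm (residual X v))"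
proof -
  obtain w where w: "\<forall>x\<in>X. combination X w x = \<mu> x"
    using interpolation[OF X \<mu>_in_H] by blast
  then have zero: "\<forall>x\<in>X. residual X w x = 0" by (simp add: residual_def)
  let ?r = "residual X w"
  note r = residual_in_H[OF X(2), of w]
  have *: "ip ?r (residual X v) = L ?r" for v
    using ip_residual[OF X(2) r, of v] zero by (simp add: quad_rule_def)
  have "nrm ?r \<le> nrm (residual X v)" for v
  proof -
    have "nrm ?r * nrm ?r = ip ?r (residual X v)"
      using nrm_square[OF r] *[of v] *[of w] by (simp add: power2_eq_square)
    also have "\<dots> \<le> nrm ?r * nrm (residual X v)"
      using cauchy_schwarz[OF r residual_in_H[OF X(2), of v]] by simp
    finally show ?thesis
      using nrm_ge_0[OF r] nrm_ge_0[OF residual_in_H[OF X(2), of v]]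
      by (cases "nrm ?r = 0") auto
  qed
  with zero show ?thesis by blast
qed

text \<open>\<open>arg_min\<close> is a choice, so a minimiser must be exhibited before it can be
  compared with anything.\<close>

lemma wce_arg_min_le:
  assumes X: "finite X" "X \<subseteq> S"
  shows "wce (quad_rule X (arg_min (\<lambda>w. wce (quad_rule X w)) (\<lambda>_. True))) \<le> nrm (residual X v)"
proof -
  let ?e = "\<lambda>w. wce (quad_rule X w)"
  obtain w where w: "\<forall>v. nrm (residual X w) \<le> nrm (residual X v)"
    using optimal_weights[OF X] by blast
  have "\<exists>w. is_arg_min ?e (\<lambda>_. True) w"
    using w by (intro exI[of _ w]) (auto simp: is_arg_min_def wce_quad_rule[OF X(2)] not_less)
  then have "is_arg_min ?e (\<lambda>_. True) (arg_min ?e (\<lambda>_. True))"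
    unfolding arg_min_def by (rule someI_ex)
  then show ?thesis
    by (auto simp: is_arg_min_def not_less wce_quad_rule[OF X(2), symmetric])
qed

end

lemma (in psd_kernel) rkhs_space_rkhs: "rkhs_space S K (rkhs_funs S K) (snd (rkhs S K))"
proof
  have "is_rkhs S K (fst (maH, ip)) (snd (maH, ip))" by (simp add: moore_aronszajn)
  then show "is_rkhs S K (rkhs_funs S K) (snd (rkhs S K))"
    unfolding rkhs_funs_def rkhs_def by (rule someI)
qed

section \<open>Gaussian kernels\<close>

lemma kform_const_one: "kform (\<lambda>_ _. 1) X w w = (\<Sum>x\<in>X. w x)\<^sup>2"
  by (simp add: kform_def sum_distrib_right power2_eq_square)

text \<open>The Schur product argument for a factor of finite rank: the factor is absorbed into the
  weights.\<close>

lemma kform_mult_inner: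
  "kform (\<lambda>x y. K x y * (\<Sum>i\<in>I. a i x * a i y)) X w w =
     (\<Sum>i\<in>I. kform K X (\<lambda>x. w x * a i x) (\<lambda>x. w x * a i x))"
proof -
  have "kform (\<lambda>x y. K x y * (\<Sum>i\<in>I. a i x * a i y)) X w w =
     (\<Sum>x\<in>X. \<Sum>y\<in>X. \<Sum>i\<in>I. w x * (w y * (K x y * (a i x * a i y))))"
    by (simp add: kform_def sum_distrib_left)
  also have "\<dots> = (\<Sum>x\<in>X. \<Sum>i\<in>I. \<Sum>y\<in>X. w x * (w y * (K x y * (a i x * a i y))))"
    by (intro sum.cong refl sum.swap)
  also have "\<dots> = (\<Sum>i\<in>I. \<Sum>x\<in>X. \<Sum>y\<in>X. w x * (w y * (K x y * (a i x * a i y))))"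
    by (rule sum.swap)
  also have "\<dots> = (\<Sum>i\<in>I. kform K X (\<lambda>x. w x * a i x) (\<lambda>x. w x * a i x))"
    by (simp add: kform_def sum_distrib_left mult_ac)
  finally show ?thesis .
qed

lemma kform_inner_power_nonneg:
  "0 \<le> kform (\<lambda>x y. (\<Sum>i\<in>I. a i x * a i y) ^ n) X w w"
proof (induction n arbitrary: w)
  case 0
  then show ?case by (simp add: kform_const_one)
next
  case (Suc n)
  have "kform (\<lambda>x y. (\<Sum>i\<in>I. a i x * a i y) ^ n * (\<Sum>i\<in>I. a i x * a i y)) X w w \<ge> 0"
    unfolding kform_mult_inner by (intro sum_nonneg Suc.IH)
  then show ?case by (simp add: mult.commute)
qed

lemma kform_exp_inner_nonneg:
  "0 \<le> kform (\<lambda>x y. exp (\<Sum>i\<in>I. a i x * a i y)) X w w"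
proof -
  let ?s = "\<lambda>x y. \<Sum>i\<in>I. a i x * a i y"
  have "(\<lambda>n. ?s x y ^ n /\<^sub>R fact n) sums exp (?s x y)" for x y
    by (rule exp_converges)
  then have "(\<lambda>n. w x * (w y * (?s x y ^ n / fact n))) sums (w x * (w y * exp (?s x y)))" for x y
    by (intro sums_mult) (simp add: divide_inverse mult.commute)
  then have sums: "(\<lambda>n. \<Sum>x\<in>X. \<Sum>y\<in>X. w x * (w y * (?s x y ^ n / fact n))) sums
      (\<Sum>x\<in>X. \<Sum>y\<in>X. w x * (w y * exp (?s x y)))"
    by (intro sums_sum)
  have pos: "0 \<le> (\<Sum>x\<in>X. \<Sum>y\<in>X. w x * (w y * (?s x y ^ n / fact n)))" for n
  proof -
    have "(\<Sum>x\<in>X. \<Sum>y\<in>X. w x * (w y * (?s x y ^ n / fact n))) =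
        kform (\<lambda>x y. ?s x y ^ n) X w w / fact n"
      by (simp add: kform_def sum_distrib_left sum_divide_distrib)
    also have "\<dots> \<ge> 0" by (intro divide_nonneg_nonneg kform_inner_power_nonneg) simp
    finally show ?thesis .
  qed
  have "0 \<le> (\<Sum>x\<in>X. \<Sum>y\<in>X. w x * (w y * exp (?s x y)))"
    by (rule sums_le[OF pos sums_zero sums])
  then show ?thesis by (simp add: kform_def sum_distrib_left)
qed

text \<open>Expanding the square leaves the exponential of an inner product, multiplied by one
  factor \<open>g\<close> in each variable; the factors are absorbed into the weights, and the
  exponential is a series of nonnegative forms.\<close>

lemma kform_gauss_nonneg:
  fixes u :: "'i \<Rightarrow> 'a \<Rightarrow> real"
  shows "0 \<le> kform (\<lambda>x y. exp (\<Sum>i\<in>I. - (u i x - u i y)\<^sup>2 / (2 * (c i)\<^sup>2))) X w w"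
proof -
  define a where "a i x = u i x / c i" for i x
  define g where "g x = exp (\<Sum>i\<in>I. - (a i x)\<^sup>2 / 2)" for x
  have "- (u i x - u i y)\<^sup>2 / (2 * (c i)\<^sup>2) = - (a i x)\<^sup>2 / 2 + (- (a i y)\<^sup>2 / 2 + a i x * a i y)"
    for i x y
    \<comment> \<open>For \<open>c i = 0\<close> both sides are 0 by division by zero, so the
      Gaussian spaces are available for all \<open>l\<close> without a sign condition.\<close>
    by (cases "c i = 0") (simp_all add: a_def power2_eq_square field_simps)
  then have "exp (\<Sum>i\<in>I. - (u i x - u i y)\<^sup>2 / (2 * (c i)\<^sup>2)) =
      g x * (g y * exp (\<Sum>i\<in>I. a i x * a i y))" for x y
    by (simp only: g_def exp_add[symmetric] sum.distrib[symmetric])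
  then have "kform (\<lambda>x y. exp (\<Sum>i\<in>I. - (u i x - u i y)\<^sup>2 / (2 * (c i)\<^sup>2))) X w w =
      kform (\<lambda>x y. exp (\<Sum>i\<in>I. a i x * a i y)) X (\<lambda>x. w x * g x) (\<lambda>x. w x * g x)"
    by (simp add: kform_def sum_distrib_left mult_ac)
  then show ?thesis using kform_exp_inner_nonneg by metis
qed

lemma gauss_kernel_exp:
  "gauss_kernel d l = (\<lambda>x y. exp (\<Sum>i\<in>{1..d}. - (x i - y i)\<^sup>2 / (2 * (l i)\<^sup>2)))"
  by (simp add: gauss_kernel_def exp_sum fun_eq_iff)

lemma gauss_kernel1_commute: "gauss_kernel1 l x y = gauss_kernel1 l y x"
  by (simp add: gauss_kernel1_def power2_commute)

lemma gauss_kernel1_le_1: "gauss_kernel1 l x y \<le> 1"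
  by (simp add: gauss_kernel1_def)

lemma gauss_kernel1_diag: "gauss_kernel1 l x x = 1"
  by (simp add: gauss_kernel1_def)

lemma gauss_kernel_prod: "gauss_kernel d l x y = (\<Prod>i=1..d. gauss_kernel1 (l i) (x i) (y i))"
  by (simp add: gauss_kernel_def gauss_kernel1_def)

lemma gauss_kernel_diag: "gauss_kernel d l x x = 1"
  by (simp add: gauss_kernel_def)

interpretation gk1: rkhs_space UNIV "gauss_kernel1 l" "rkhs_funs UNIV (gauss_kernel1 l)"
  "snd (rkhs UNIV (gauss_kernel1 l))" for l
proof (rule psd_kernel.rkhs_space_rkhs, unfold_locales)
  fix X :: "real set" and w
  show "0 \<le> kform (gauss_kernel1 l) X w w"
    using kform_gauss_nonneg[where I = "{()}" and u = "\<lambda>_ x. x" and c = "\<lambda>_. l"]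
    by (simp add: gauss_kernel1_def[abs_def])
qed (rule gauss_kernel1_commute)

interpretation gk: rkhs_space "Rn d" "gauss_kernel d l" "rkhs_funs (Rn d) (gauss_kernel d l)"
  "snd (rkhs (Rn d) (gauss_kernel d l))" for d l
proof (rule psd_kernel.rkhs_space_rkhs, unfold_locales)
  show "0 \<le> kform (gauss_kernel d l) X w w" for X w
    unfolding gauss_kernel_exp by (rule kform_gauss_nonneg)
next
  show "gauss_kernel d l x y = gauss_kernel d l y x" for x y
    unfolding gauss_kernel_prod by (intro prod.cong refl gauss_kernel1_commute)
qed

lemma gk1_nrm: "gk1.nrm l = rkhs_norm UNIV (gauss_kernel1 l)"
  by (intro ext) (simp only: gk1.nrm_def rkhs_norm_def)

lemma gk_nrm: "gk.nrm d l = rkhs_norm (Rn d) (gauss_kernel d l)"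
  by (intro ext) (simp only: gk.nrm_def rkhs_norm_def)

section \<open>Gaussian integrals of Gaussian kernels\<close>

definition gint1 :: "real \<Rightarrow> (real \<Rightarrow> real) \<Rightarrow> real" where
  "gint1 a f = (\<integral>x. f x * normal_density 0 a x \<partial>lborel)"

definition mean1 :: "real \<Rightarrow> real \<Rightarrow> real \<Rightarrow> real" where
  "mean1 l a y = gint1 a (\<lambda>x. gauss_kernel1 l x y)"

lemma integrable_bounded_normal_density:
  assumes "f \<in> borel_measurable borel" "\<And>x. \<bar>f x\<bar> \<le> B" "a > 0"
  shows "integrable lborel (\<lambda>x. f x * normal_density 0 a x)"
proof (rule Bochner_Integration.integrable_bound[of _ "\<lambda>x. B * normal_density 0 a x"])
  show "AE x in lborel. norm (f x * normal_density 0 a x) \<le> norm (B * normal_density 0 a x)"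
  proof (rule AE_I2)
    fix x
    have "\<bar>f x\<bar> \<le> \<bar>B\<bar>" using assms(2)[of x] by linarith
    then show "norm (f x * normal_density 0 a x) \<le> norm (B * normal_density 0 a x)"
      by (simp add: abs_mult mult_right_mono)
  qed
qed (use assms in auto)

lemma gauss_kernel1_normal_density:
  "l > 0 \<Longrightarrow> gauss_kernel1 l x y = sqrt (2 * pi) * l * normal_density 0 l (x - y)"
  by (simp add: gauss_kernel1_def normal_density_def real_sqrt_mult)

text \<open>The kernel is a multiple of a normal density, so its Gaussian mean is a convolution of
  two centred normal densities, and their variances add.\<close>

lemma mean1_eq:
  assumes "l > 0" "a > 0"
  shows "mean1 l a y = sqrt (2 * pi) * l * normal_density 0 (sqrt (l\<^sup>2 + a\<^sup>2)) y"
proof -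
  have "(\<integral>x. normal_density 0 l (y - x) * normal_density 0 a x \<partial>lborel) =
      enn2real (\<integral>\<^sup>+x. ennreal (normal_density 0 l (y - x) * normal_density 0 a x) \<partial>lborel)"
    by (intro integral_eq_nn_integral) auto
  also have "\<dots> = normal_density 0 (sqrt (l\<^sup>2 + a\<^sup>2)) y"
    using conv_normal_density_zero_mean[OF assms, THEN fun_cong, of y] by simp
  finally have "(\<integral>x. normal_density 0 l (y - x) * normal_density 0 a x \<partial>lborel) = \<dots>" .
  then show ?thesis
    using assms
    by (simp add: mean1_def gint1_def gauss_kernel1_commute[of l _ y] gauss_kernel1_normal_density mult.assoc)
qed

text \<open>\<open>mean1 l a\<close> is itself a multiple of a Gaussian kernel, of width
  \<open>t\<close>, so the convolution formula applies a second time and the total variance is l^2 +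
  2 a^2.\<close>

lemma gint1_mean1:
  assumes "l > 0" "a > 0"
  shows "gint1 a (mean1 l a) = (1 + 2 * a\<^sup>2 / l\<^sup>2) powr (- 1 / 2)"
proof -
  define t where "t = sqrt (l\<^sup>2 + a\<^sup>2)"
  have t: "t > 0" using assms by (simp add: t_def add_pos_pos)
  have "mean1 l a y = l / t * gauss_kernel1 t y 0" for y
    using t by (simp add: mean1_eq[OF assms] t_def[symmetric] gauss_kernel1_normal_density[OF t])
  then have "gint1 a (mean1 l a) = l / t * mean1 t a 0"
    by (simp add: gint1_def mean1_def mult.assoc flip: integral_mult_right_zero)
  also have "\<dots> = l / sqrt (t\<^sup>2 + a\<^sup>2)"
    using t assms by (simp add: mean1_eq normal_density_def real_sqrt_mult)
  also have "t\<^sup>2 + a\<^sup>2 = l\<^sup>2 * (1 + 2 * a\<^sup>2 / l\<^sup>2)"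
    using assms by (simp add: t_def field_simps)
  also have "l / sqrt (l\<^sup>2 * (1 + 2 * a\<^sup>2 / l\<^sup>2)) = inverse (sqrt (1 + 2 * a\<^sup>2 / l\<^sup>2))"
    using assms by (simp add: real_sqrt_mult divide_inverse)
  also have "\<dots> = (1 + 2 * a\<^sup>2 / l\<^sup>2) powr (- 1 / 2)"
    using assms by (simp add: powr_minus powr_half_sqrt add_nonneg_nonneg)
  finally show ?thesis .
qed

lemma isCont_gauss_kernel1: "isCont (\<lambda>x. gauss_kernel1 l x y) z"
proof (cases "l = 0")
  case False
  then show ?thesis unfolding gauss_kernel1_def by (intro continuous_intros) simp
qed (simp add: gauss_kernel1_def)

lemma gk1_continuous:
  assumes "f \<in> rkhs_funs UNIV (gauss_kernel1 l)"
  shows "isCont f x"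
proof (rule gk1.isCont_compose[OF assms, where \<phi> = "\<lambda>y. y"])
  show "((\<lambda>y. gauss_kernel1 l y y - 2 * gauss_kernel1 l y x + gauss_kernel1 l x x) \<longlongrightarrow> 0) (at x)"
  proof -
    have "((\<lambda>y. 2 - 2 * gauss_kernel1 l y x) \<longlongrightarrow> 2 - 2 * gauss_kernel1 l x x) (at x)"
      by (intro tendsto_intros isCont_gauss_kernel1[unfolded isCont_def])
    then show ?thesis by (simp add: gauss_kernel1_diag)
  qed
qed simp

lemma gk1_measurable [measurable]:
  "f \<in> rkhs_funs UNIV (gauss_kernel1 l) \<Longrightarrow> f \<in> borel_measurable borel"
  by (intro borel_measurable_continuous_onI continuous_at_imp_continuous_on ballI gk1_continuous)

lemma gk1_abs_le: "f \<in> rkhs_funs UNIV (gauss_kernel1 l) \<Longrightarrow> \<bar>f x\<bar> \<le> gk1.nrm l f"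
  using gk1.abs_eval_le[of f l x] by (simp add: gauss_kernel1_diag)

lemma gk1_integrable:
  assumes "a > 0" "f \<in> rkhs_funs UNIV (gauss_kernel1 l)"
  shows "integrable lborel (\<lambda>x. f x * normal_density 0 a x)"
  by (rule integrable_bounded_normal_density[OF gk1_measurable gk1_abs_le]) (use assms in auto)

lemma abs_integral_normal_le:
  assumes "a > 0" "\<And>x. \<bar>f x\<bar> \<le> B"
  shows "\<bar>gint1 a f\<bar> \<le> B"
proof (cases "integrable lborel (\<lambda>x. f x * normal_density 0 a x)")
  case True
  have "\<bar>gint1 a f\<bar> \<le> (\<integral>x. \<bar>f x * normal_density 0 a x\<bar> \<partial>lborel)"
    unfolding gint1_def by (rule integral_abs_bound)
  also have "\<dots> \<le> (\<integral>x. B * normal_density 0 a x \<partial>lborel)"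
    using True assms
    by (intro integral_mono integrable_abs) (auto simp: abs_mult intro: mult_right_mono)
  also have "\<dots> = B" using assms(1) by simp
  finally show ?thesis .
next
  \<comment> \<open>The integral is then 0 by default, and \<open>B\<close> is nonnegative because
    it bounds an absolute value.\<close>
  case False
  then show ?thesis
    using assms(2)[of 0] by (simp add: gint1_def not_integrable_integral_eq)
qed

text \<open>Membership of \<open>mean1 l a\<close> in the space is not shown directly: an abstract
  representer exists, and its pairing with the section at \<open>y\<close> identifies it
  pointwise.\<close>

lemma rkhs_functional_gauss1:
  assumes "a > 0"
  shows "rkhs_functional UNIV (gauss_kernel1 l) (rkhs_funs UNIV (gauss_kernel1 l))
     (snd (rkhs UNIV (gauss_kernel1 l))) (gint1 a) (mean1 l a)"
proof -
  obtain \<mu> where \<mu>: "\<mu> \<in> rkhs_funs UNIV (gauss_kernel1 l)"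
    "\<And>f. f \<in> rkhs_funs UNIV (gauss_kernel1 l) \<Longrightarrow> snd (rkhs UNIV (gauss_kernel1 l)) f \<mu> = gint1 a f"
  proof -
    have "\<exists>\<mu>\<in>rkhs_funs UNIV (gauss_kernel1 l). \<forall>f\<in>rkhs_funs UNIV (gauss_kernel1 l).
        snd (rkhs UNIV (gauss_kernel1 l)) f \<mu> = gint1 a f"
    proof (rule gk1.riesz)
      show "gint1 a (\<lambda>x. f x + g x) = gint1 a f + gint1 a g"
        if "f \<in> rkhs_funs UNIV (gauss_kernel1 l)" "g \<in> rkhs_funs UNIV (gauss_kernel1 l)" for f g
        unfolding gint1_def
        using gk1_integrable[OF \<open>a > 0\<close> that(1)] gk1_integrable[OF \<open>a > 0\<close> that(2)]
        by (simp add: distrib_right)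
      show "gint1 a (\<lambda>x. c * f x) = c * gint1 a f" for f c
        by (simp add: gint1_def mult.assoc)
      show "\<bar>gint1 a f\<bar> \<le> 1 * gk1.nrm l f" if "f \<in> rkhs_funs UNIV (gauss_kernel1 l)" for f
        using abs_integral_normal_le[OF \<open>a > 0\<close> gk1_abs_le[OF that]] by simp
    qed
    then show ?thesis using that by blast
  qed
  have "\<mu> y = mean1 l a y" for y
  proof -
    have "\<mu> y = snd (rkhs UNIV (gauss_kernel1 l)) \<mu> (gk1.section_at l y)"
      using gk1.ip_section[of y \<mu> l] \<mu>(1) by simp
    also have "\<dots> = snd (rkhs UNIV (gauss_kernel1 l)) (gk1.section_at l y) \<mu>"
      by (rule gk1.ip_sym[OF \<mu>(1) gk1.section_in_H]) simp
    also have "\<dots> = gint1 a (gk1.section_at l y)" by (intro \<mu>(2) gk1.section_in_H) simp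
    finally show ?thesis by (simp add: gk1.section_at_def mean1_def)
  qed
  then have "\<mu> = mean1 l a" by auto
  then show ?thesis
    using \<mu> by unfold_locales auto
qed

section \<open>The multivariate Gaussian functional\<close>

lemma gauss_integral_normal_density:
  assumes \<alpha>: "\<forall>i\<in>{1..d}. \<alpha> i > 0"
  shows "gauss_integral d \<alpha> f =
    (\<integral>x. f x * (\<Prod>i=1..d. normal_density 0 (\<alpha> i) (x i)) \<partial>(Pi\<^sub>M {1..d} (\<lambda>_. lborel)))"
proof -
  have "(\<Prod>i=1..d. 1 / (sqrt (2 * pi) * \<alpha> i) * exp (- (x i)\<^sup>2 / (2 * (\<alpha> i)\<^sup>2))) =
      (\<Prod>i=1..d. normal_density 0 (\<alpha> i) (x i))" for x :: "nat \<Rightarrow> real"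
  proof (rule prod.cong)
    fix i assume "i \<in> {1..d}"
    then have "\<alpha> i > 0" using \<alpha> by blast
    then show "1 / (sqrt (2 * pi) * \<alpha> i) * exp (- (x i)\<^sup>2 / (2 * (\<alpha> i)\<^sup>2)) =
        normal_density 0 (\<alpha> i) (x i)"
      by (simp add: normal_density_def real_sqrt_mult)
  qed simp
  then show ?thesis by (simp add: gauss_integral_def)
qed

lemma integrable_prod_lborel:
  fixes f :: "nat \<Rightarrow> real \<Rightarrow> real"
  assumes "\<And>i. i \<in> {1..d} \<Longrightarrow> integrable lborel (f i)"
  shows "integrable (Pi\<^sub>M {1..d} (\<lambda>_. lborel)) (\<lambda>x. \<Prod>i=1..d. f i (x i))"
proof -
  interpret product_sigma_finite "\<lambda>_::nat. lborel :: real measure" by standard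
  show ?thesis by (rule product_integrable_prod) (use assms in auto)
qed

lemma integral_prod_lborel:
  fixes f :: "nat \<Rightarrow> real \<Rightarrow> real"
  assumes "\<And>i. i \<in> {1..d} \<Longrightarrow> integrable lborel (f i)"
  shows "(\<integral>x. (\<Prod>i=1..d. f i (x i)) \<partial>(Pi\<^sub>M {1..d} (\<lambda>_. lborel))) = (\<Prod>i=1..d. \<integral>x. f i x \<partial>lborel)"
proof -
  interpret product_sigma_finite "\<lambda>_::nat. lborel :: real measure" by standard
  show ?thesis by (rule product_integral_prod) (use assms in auto)
qed

lemma gauss_integral_prod:
  assumes \<alpha>: "\<forall>i\<in>{1..d}. \<alpha> i > 0"
    and f: "\<And>i. i \<in> {1..d} \<Longrightarrow> integrable lborel (\<lambda>x. f i x * normal_density 0 (\<alpha> i) x)"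
    and g: "\<And>x. x \<in> Rn d \<Longrightarrow> g x = (\<Prod>i=1..d. f i (x i))"
  shows "gauss_integral d \<alpha> g = (\<Prod>i=1..d. gint1 (\<alpha> i) (f i))"
proof -
  have "gauss_integral d \<alpha> g =
      (\<integral>x. (\<Prod>i=1..d. f i (x i) * normal_density 0 (\<alpha> i) (x i)) \<partial>(Pi\<^sub>M {1..d} (\<lambda>_. lborel)))"
    unfolding gauss_integral_normal_density[OF \<alpha>]
    by (rule Bochner_Integration.integral_cong) (simp_all add: space_PiM g prod.distrib)
  also have "\<dots> = (\<Prod>i=1..d. gint1 (\<alpha> i) (f i))"
    unfolding gint1_def by (rule integral_prod_lborel) (rule f)
  finally show ?thesis .
qed

text \<open>The product measure lives on extensional functions, while continuity is available on all
  functions. The restriction map connects them: \<open>f\<close> after restriction is continuous,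
  hence Borel; restriction is measurable coordinatewise; and on the space of the product measure it
  is the identity.\<close>

lemma gk_measurable:
  assumes f: "f \<in> rkhs_funs (Rn d) (gauss_kernel d l)"
  shows "f \<in> borel_measurable (Pi\<^sub>M {1..d} (\<lambda>_. lborel))"
proof -
  let ?\<phi> = "\<lambda>x::nat \<Rightarrow> real. restrict x {1..d}"
  have "isCont (\<lambda>x. f (?\<phi> x)) x" for x
  proof (rule gk.isCont_compose[OF f])
    have "((\<lambda>y. gauss_kernel1 (l i) (?\<phi> y i) (?\<phi> x i)) \<longlongrightarrow> gauss_kernel1 (l i) (?\<phi> x i) (?\<phi> x i)) (at x)"
      if "i \<in> {1..d}" for i
    proof -
      have "((\<lambda>y::nat \<Rightarrow> real. y i) \<longlongrightarrow> x i) (at x)"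
        using continuous_on_product_coordinates[of i] unfolding continuous_on_def by blast
      with isCont_gauss_kernel1 have "((\<lambda>y::nat \<Rightarrow> real. gauss_kernel1 (l i) (y i) (x i)) \<longlongrightarrow> gauss_kernel1 (l i) (x i) (x i)) (at x)"
        by (rule isCont_tendsto_compose)
      then show ?thesis using that by simp
    qed
    then have "((\<lambda>y. gauss_kernel d l (?\<phi> y) (?\<phi> x)) \<longlongrightarrow> gauss_kernel d l (?\<phi> x) (?\<phi> x)) (at x)"
      unfolding gauss_kernel_prod by (rule tendsto_prod)
    then have "((\<lambda>y. 2 - 2 * gauss_kernel d l (?\<phi> y) (?\<phi> x)) \<longlongrightarrow> 2 - 2 * gauss_kernel d l (?\<phi> x) (?\<phi> x)) (at x)"
      by (intro tendsto_intros)
    then show "((\<lambda>y. gauss_kernel d l (?\<phi> y) (?\<phi> y) - 2 * gauss_kernel d l (?\<phi> y) (?\<phi> x)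
        + gauss_kernel d l (?\<phi> x) (?\<phi> x)) \<longlongrightarrow> 0) (at x)"
      by (simp add: gauss_kernel_diag)
  qed auto
  then have "(\<lambda>x. f (?\<phi> x)) \<in> borel_measurable borel"
    by (intro borel_measurable_continuous_onI continuous_at_imp_continuous_on) auto
  moreover have "?\<phi> \<in> borel_measurable (Pi\<^sub>M {1..d} (\<lambda>_. lborel))"
  proof (rule measurable_coordinatewise_then_product)
    fix i
    show "(\<lambda>x. ?\<phi> x i) \<in> borel_measurable (Pi\<^sub>M {1..d} (\<lambda>_. lborel))"
      using measurable_component_singleton[of i "{1..d}" "\<lambda>_. lborel"] by (cases "i \<in> {1..d}") auto
  qed
  ultimately have m: "(\<lambda>x. f (?\<phi> (?\<phi> x))) \<in> borel_measurable (Pi\<^sub>M {1..d} (\<lambda>_. lborel))"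
    by (rule measurable_compose[rotated])
  have eq: "f (?\<phi> (?\<phi> x)) = f x" if "x \<in> space (Pi\<^sub>M {1..d} (\<lambda>_. lborel))" for x
    using that by (simp add: space_PiM PiE_restrict)
  show ?thesis by (rule iffD1[OF measurable_cong m]) (rule eq)
qed

lemma gk_abs_le:
  assumes "f \<in> rkhs_funs (Rn d) (gauss_kernel d l)"
  shows "\<bar>f x\<bar> \<le> gk.nrm d l f"
proof (cases "x \<in> Rn d")
  case True
  then show ?thesis using gk.abs_eval_le[OF assms] by (simp only: gauss_kernel_diag) simp
next
  case False
  then show ?thesis using gk.H_outside[OF assms False] gk.nrm_ge_0[OF assms] by (simp only: abs_zero)
qed

lemma gk_integrable:
  assumes \<alpha>: "\<forall>i\<in>{1..d}. \<alpha> i > 0"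
    and f: "f \<in> rkhs_funs (Rn d) (gauss_kernel d l)"
  shows "integrable (Pi\<^sub>M {1..d} (\<lambda>_. lborel)) (\<lambda>x. f x * (\<Prod>i=1..d. normal_density 0 (\<alpha> i) (x i)))"
proof (rule Bochner_Integration.integrable_bound)
  let ?M = "Pi\<^sub>M {1..d} (\<lambda>_. lborel :: real measure)"
  have dens: "integrable ?M (\<lambda>x. \<Prod>i=1..d. normal_density 0 (\<alpha> i) (x i))"
    by (rule integrable_prod_lborel) (use \<alpha> in auto)
  then show "integrable ?M (\<lambda>x. gk.nrm d l f * (\<Prod>i=1..d. normal_density 0 (\<alpha> i) (x i)))"
    by (rule integrable_mult_right)
  show "(\<lambda>x. f x * (\<Prod>i=1..d. normal_density 0 (\<alpha> i) (x i))) \<in> borel_measurable ?M"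
    using gk_measurable[OF f] borel_measurable_integrable[OF dens] by (rule borel_measurable_times)
  show "AE x in ?M. norm (f x * (\<Prod>i=1..d. normal_density 0 (\<alpha> i) (x i)))
      \<le> norm (gk.nrm d l f * (\<Prod>i=1..d. normal_density 0 (\<alpha> i) (x i)))"
  proof (rule AE_I2)
    fix x
    have "\<bar>f x\<bar> \<le> \<bar>gk.nrm d l f\<bar>" using gk_abs_le[OF f, of x] by linarith
    then show "norm (f x * (\<Prod>i=1..d. normal_density 0 (\<alpha> i) (x i)))
      \<le> norm (gk.nrm d l f * (\<Prod>i=1..d. normal_density 0 (\<alpha> i) (x i)))"
      unfolding real_norm_def abs_mult by (rule mult_right_mono) simp
  qed
qed

lemma abs_gauss_integral_le:
  assumes \<alpha>: "\<forall>i\<in>{1..d}. \<alpha> i > 0"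
    and f: "f \<in> rkhs_funs (Rn d) (gauss_kernel d l)"
  shows "\<bar>gauss_integral d \<alpha> f\<bar> \<le> gk.nrm d l f"
proof -
  let ?M = "Pi\<^sub>M {1..d} (\<lambda>_. lborel :: real measure)"
  let ?p = "\<lambda>x. \<Prod>i=1..d. normal_density 0 (\<alpha> i) (x i)"
  have dens: "integrable ?M ?p" by (rule integrable_prod_lborel) (use \<alpha> in auto)
  have "\<bar>gauss_integral d \<alpha> f\<bar> \<le> (\<integral>x. \<bar>f x * ?p x\<bar> \<partial>?M)"
    unfolding gauss_integral_normal_density[OF \<alpha>] by (rule integral_abs_bound)
  also have "\<dots> \<le> (\<integral>x. gk.nrm d l f * ?p x \<partial>?M)"
  proof (rule integral_mono)
    show "integrable ?M (\<lambda>x. \<bar>f x * ?p x\<bar>)" by (rule integrable_abs[OF gk_integrable[OF \<alpha> f]])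
    show "integrable ?M (\<lambda>x. gk.nrm d l f * ?p x)" by (rule integrable_mult_right[OF dens])
    have "0 \<le> ?p x" for x by (intro prod_nonneg) simp
    then show "\<bar>f x * ?p x\<bar> \<le> gk.nrm d l f * ?p x" for x
      using gk_abs_le[OF f, of x] by (simp only: abs_mult abs_of_nonneg) (rule mult_right_mono)
  qed
  also have "\<dots> = gk.nrm d l f * (\<integral>x. ?p x \<partial>?M)" by simp
  also have "(\<integral>x. ?p x \<partial>?M) = (\<Prod>i=1..d. \<integral>x. normal_density 0 (\<alpha> i) x \<partial>lborel)"
    by (rule integral_prod_lborel) (use \<alpha> in auto)
  also have "\<dots> = 1" using \<alpha> by (intro prod.neutral) auto
  finally show ?thesis by simp
qed

text \<open>The product form reflects that kernel and density both factorise. The value 0 off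
  \<open>Rn d\<close> follows the convention that elements of the space are extended by
  zero.\<close>

definition mean :: "nat \<Rightarrow> (nat \<Rightarrow> real) \<Rightarrow> (nat \<Rightarrow> real) \<Rightarrow> (nat \<Rightarrow> real) \<Rightarrow> real" where
  "mean d l \<alpha> y = (if y \<in> Rn d then \<Prod>i=1..d. mean1 (l i) (\<alpha> i) (y i) else 0)"

lemma rkhs_functional_gauss:
  assumes \<alpha>: "\<forall>i\<in>{1..d}. \<alpha> i > 0"
  shows "rkhs_functional (Rn d) (gauss_kernel d l) (rkhs_funs (Rn d) (gauss_kernel d l))
     (snd (rkhs (Rn d) (gauss_kernel d l))) (gauss_integral d \<alpha>) (mean d l \<alpha>)"
proof -
  let ?H = "rkhs_funs (Rn d) (gauss_kernel d l)" and ?ip = "snd (rkhs (Rn d) (gauss_kernel d l))"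
  have "\<exists>\<mu>\<in>?H. \<forall>f\<in>?H. ?ip f \<mu> = gauss_integral d \<alpha> f"
  proof (rule gk.riesz)
    show "gauss_integral d \<alpha> (\<lambda>x. f x + g x) = gauss_integral d \<alpha> f + gauss_integral d \<alpha> g"
      if "f \<in> ?H" "g \<in> ?H" for f g
      unfolding gauss_integral_normal_density[OF \<alpha>] distrib_right
      by (rule Bochner_Integration.integral_add; rule gk_integrable[OF \<alpha>]; fact that)
    show "gauss_integral d \<alpha> (\<lambda>x. c * f x) = c * gauss_integral d \<alpha> f" for f c
      unfolding gauss_integral_normal_density[OF \<alpha>] by (simp add: mult.assoc)
    show "\<bar>gauss_integral d \<alpha> f\<bar> \<le> 1 * gk.nrm d l f" if "f \<in> ?H" for f
      using abs_gauss_integral_le[OF \<alpha> that] by simp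
  qed
  then obtain \<mu> where \<mu>: "\<mu> \<in> ?H" "\<And>f. f \<in> ?H \<Longrightarrow> ?ip f \<mu> = gauss_integral d \<alpha> f"
    by blast
  have "\<mu> y = mean d l \<alpha> y" for y
  proof (cases "y \<in> Rn d")
    case True
    have "\<mu> y = ?ip \<mu> (gk.section_at d l y)" by (rule gk.ip_section[OF True \<mu>(1), symmetric])
    also have "\<dots> = ?ip (gk.section_at d l y) \<mu>"
      by (rule gk.ip_sym[OF \<mu>(1) gk.section_in_H[OF True]])
    also have "\<dots> = gauss_integral d \<alpha> (gk.section_at d l y)"
      by (rule \<mu>(2)[OF gk.section_in_H[OF True]])
    also have "\<dots> = (\<Prod>i=1..d. gint1 (\<alpha> i) (\<lambda>x. gauss_kernel1 (l i) x (y i)))"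
    proof (rule gauss_integral_prod[OF \<alpha>])
      show "integrable lborel (\<lambda>x. gauss_kernel1 (l i) x (y i) * normal_density 0 (\<alpha> i) x)"
        if "i \<in> {1..d}" for i
        by (rule integrable_bounded_normal_density[where B = 1])
          (use bspec[OF \<alpha> that] in \<open>auto simp: gauss_kernel1_def\<close>)
      show "gk.section_at d l y x = (\<Prod>i=1..d. gauss_kernel1 (l i) (x i) (y i))" if "x \<in> Rn d" for x
        unfolding gk.section_at_def using that by (simp only: if_True gauss_kernel_prod)
    qed
    finally show ?thesis using True by (simp add: mean_def mean1_def)
  next
    case False
    then show ?thesis using gk.H_outside[OF \<mu>(1) False] by (simp add: mean_def)
  qed
  then have "\<mu> = mean d l \<alpha>" by (rule ext)
  then show ?thesis
    using \<mu> by unfold_locales auto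
qed

lemma gauss_integral_mean:
  assumes \<alpha>: "\<forall>i\<in>{1..d}. \<alpha> i > 0"
  shows "gauss_integral d \<alpha> (mean d l \<alpha>) = (\<Prod>i=1..d. gint1 (\<alpha> i) (mean1 (l i) (\<alpha> i)))"
proof (rule gauss_integral_prod[OF \<alpha>])
  fix i assume i: "i \<in> {1..d}"
  interpret rkhs_functional UNIV "gauss_kernel1 (l i)" "rkhs_funs UNIV (gauss_kernel1 (l i))"
    "snd (rkhs UNIV (gauss_kernel1 (l i)))" "gint1 (\<alpha> i)" "mean1 (l i) (\<alpha> i)"
    by (rule rkhs_functional_gauss1[OF bspec[OF \<alpha> i]])
  show "integrable lborel (\<lambda>x. mean1 (l i) (\<alpha> i) x * normal_density 0 (\<alpha> i) x)"
    by (rule gk1_integrable[OF bspec[OF \<alpha> i] \<mu>_in_H])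
qed (simp only: mean_def if_True)

section \<open>Product rules\<close>

text \<open>One factor is exchanged at a time; the factors \<open>q\<close> that remain beside the
  exchanged one are enlarged to \<open>M\<close>.\<close>

lemma prod_diff_le_sum:
  fixes M q :: "'a \<Rightarrow> real"
  assumes "finite I" "\<And>i. i \<in> I \<Longrightarrow> 0 \<le> q i \<and> q i \<le> M i"
  shows "(\<Prod>i\<in>I. M i) - (\<Prod>i\<in>I. q i) \<le> (\<Sum>i\<in>I. (M i - q i) * (\<Prod>j\<in>I - {i}. M j))"
  using assms
proof (induction I rule: finite_induct)
  case (insert k I)
  have qM: "(\<Prod>i\<in>I. q i) \<le> (\<Prod>i\<in>I. M i)" using insert.prems by (intro prod_mono) auto
  have "(\<Prod>i\<in>insert k I. M i) - (\<Prod>i\<in>insert k I. q i) =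
      (M k - q k) * (\<Prod>i\<in>I. q i) + M k * ((\<Prod>i\<in>I. M i) - (\<Prod>i\<in>I. q i))"
    using insert.hyps by (simp add: algebra_simps)
  also have "\<dots> \<le> (M k - q k) * (\<Prod>i\<in>I. M i) + M k * (\<Sum>i\<in>I. (M i - q i) * (\<Prod>j\<in>I - {i}. M j))"
  proof (intro add_mono mult_left_mono qM)
    show "0 \<le> M k - q k" using insert.prems[of k] by simp
    show "0 \<le> M k" using insert.prems[of k] by auto
    show "(\<Prod>i\<in>I. M i) - (\<Prod>i\<in>I. q i) \<le> (\<Sum>i\<in>I. (M i - q i) * (\<Prod>j\<in>I - {i}. M j))"
      by (rule insert.IH) (use insert.prems in auto)
  qed
  also have "M k * (\<Sum>i\<in>I. (M i - q i) * (\<Prod>j\<in>I - {i}. M j)) =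
      (\<Sum>i\<in>I. (M i - q i) * (\<Prod>j\<in>insert k I - {i}. M j))"
    unfolding sum_distrib_left
  proof (rule sum.cong)
    fix i assume i: "i \<in> I"
    then have "insert k I - {i} = insert k (I - {i})" using insert.hyps by auto
    then show "M k * ((M i - q i) * (\<Prod>j\<in>I - {i}. M j)) = (M i - q i) * (\<Prod>j\<in>insert k I - {i}. M j)"
      using insert.hyps by simp
  qed simp
  also have "(M k - q k) * (\<Prod>i\<in>I. M i) + \<dots> =
      (\<Sum>i\<in>insert k I. (M i - q i) * (\<Prod>j\<in>insert k I - {i}. M j))"
    using insert.hyps by simp
  finally show ?case .
qed simp

text \<open>Lets the bound on the squared error be a perfect square, so that its root is a sum over
  the coordinates.\<close>

lemma sum_squares_le_square_sum:
  fixes c :: "'a \<Rightarrow> real"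
  assumes "finite I" "\<And>i. i \<in> I \<Longrightarrow> 0 \<le> c i"
  shows "(\<Sum>i\<in>I. (c i)\<^sup>2) \<le> (\<Sum>i\<in>I. c i)\<^sup>2"
  using assms
proof (induction I rule: finite_induct)
  case (insert k I)
  have "0 \<le> c k * (\<Sum>i\<in>I. c i)" using insert.prems by (intro mult_nonneg_nonneg sum_nonneg) auto
  then show ?case using insert by (simp add: power2_sum)
qed simp

lemma kform_gauss_kernel_prod:
  assumes fin: "\<And>i. i \<in> {1..d} \<Longrightarrow> finite (X i)"
  shows "kform (gauss_kernel d l) (PiE {1..d} X) (\<lambda>x. \<Prod>i=1..d. v i (x i)) (\<lambda>x. \<Prod>i=1..d. v i (x i)) =
    (\<Prod>i=1..d. kform (gauss_kernel1 (l i)) (X i) (v i) (v i))"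
proof -
  have "(\<Sum>y\<in>PiE {1..d} X. (\<Prod>i=1..d. v i (y i)) * gauss_kernel d l x y) =
      (\<Prod>i=1..d. \<Sum>b\<in>X i. v i b * gauss_kernel1 (l i) (x i) b)" for x
    unfolding gauss_kernel_prod prod.distrib[symmetric]
    by (rule prod_sum_PiE[symmetric]) (use fin in auto)
  then have "kform (gauss_kernel d l) (PiE {1..d} X) (\<lambda>x. \<Prod>i=1..d. v i (x i)) (\<lambda>x. \<Prod>i=1..d. v i (x i)) =
      (\<Sum>x\<in>PiE {1..d} X. \<Prod>i=1..d. v i (x i) * (\<Sum>b\<in>X i. v i b * gauss_kernel1 (l i) (x i) b))"
    by (simp only: kform_def prod.distrib)
  also have "\<dots> = (\<Prod>i=1..d. \<Sum>a\<in>X i. v i a * (\<Sum>b\<in>X i. v i b * gauss_kernel1 (l i) a b))"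
    by (rule prod_sum_PiE[symmetric]) (use fin in auto)
  finally show ?thesis by (simp only: kform_def)
qed

text \<open>\<open>err\<close> is the interface to one dimension: it bounds integrals of functions
  that vanish on the nodes, and is applied to the optimal one-dimensional residuals.\<close>

lemma worst_case_error_grid:
  assumes pos: "\<And>i. i \<in> {1..d} \<Longrightarrow> \<alpha> i > 0 \<and> l i > 0"
    and fin: "\<And>i. i \<in> {1..d} \<Longrightarrow> finite (X i)"
    and err: "\<And>i r. i \<in> {1..d} \<Longrightarrow> r \<in> rkhs_funs UNIV (gauss_kernel1 (l i)) \<Longrightarrow>
        (\<And>x. x \<in> X i \<Longrightarrow> r x = 0) \<Longrightarrow> gint1 (\<alpha> i) r \<le> gk1.nrm (l i) r * e i"
    and e: "\<And>i. i \<in> {1..d} \<Longrightarrow> 0 \<le> e i"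
  shows "worst_case_error d \<alpha> l (Q_opt d \<alpha> l (PiE {1..d} X)) \<le>
    (\<Sum>i=1..d. e i * (\<Prod>j\<in>{1..d} - {i}. (1 + 2 * (\<alpha> j)\<^sup>2 / (l j)\<^sup>2) powr (- 1 / 4)))"
proof -
  have \<alpha>: "\<forall>i\<in>{1..d}. \<alpha> i > 0" using pos by blast
  define M where "M i = gint1 (\<alpha> i) (mean1 (l i) (\<alpha> i))" for i
  have M: "M i = (1 + 2 * (\<alpha> i)\<^sup>2 / (l i)\<^sup>2) powr (- 1 / 2)" if "i \<in> {1..d}" for i
    unfolding M_def using pos[OF that] by (intro gint1_mean1) auto
  have M0: "0 \<le> M i" if "i \<in> {1..d}" for i
    unfolding M[OF that] by simp
  \<comment> \<open>\<open>P i w\<close> keeps what the grid needs: interpolation makes the linear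
    term of the squared error equal to the form, which leaves \<open>M i\<close> minus the
    form.\<close>
  define P where "P i w \<longleftrightarrow>
      (\<Sum>x\<in>X i. w x * mean1 (l i) (\<alpha> i) x) = kform (gauss_kernel1 (l i)) (X i) w w \<and>
      0 \<le> kform (gauss_kernel1 (l i)) (X i) w w \<and>
      kform (gauss_kernel1 (l i)) (X i) w w \<le> M i \<and>
      M i - kform (gauss_kernel1 (l i)) (X i) w w \<le> (e i)\<^sup>2" for i w
  have "\<exists>w. P i w" if i: "i \<in> {1..d}" for i
  proof -
    interpret rkhs_functional UNIV "gauss_kernel1 (l i)" "rkhs_funs UNIV (gauss_kernel1 (l i))"
      "snd (rkhs UNIV (gauss_kernel1 (l i)))" "gint1 (\<alpha> i)" "mean1 (l i) (\<alpha> i)"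
      by (rule rkhs_functional_gauss1[OF bspec[OF \<alpha> i]])
    obtain w where zero: "\<forall>x\<in>X i. residual (X i) w x = 0"
      using optimal_weights[OF fin[OF i] subset_UNIV] by blast
    let ?r = "residual (X i) w" and ?q = "kform (gauss_kernel1 (l i)) (X i) w w"
    note r = residual_in_H[OF subset_UNIV, of "X i" w]
    have "(\<Sum>x\<in>X i. w x * mean1 (l i) (\<alpha> i) x) = (\<Sum>x\<in>X i. w x * gk1.combination (l i) (X i) w x)"
      using zero by (intro sum.cong refl) (simp add: residual_def)
    also have "\<dots> = ?q" unfolding kform_def
      by (intro sum.cong refl) (simp add: gk1.combination_at)
    finally have bq: "(\<Sum>x\<in>X i. w x * mean1 (l i) (\<alpha> i) x) = ?q" .
    then have rq: "(gk1.nrm (l i) ?r)\<^sup>2 = M i - ?q"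
      by (simp add: residual_norm_square M_def)
    \<comment> \<open>The quadrature part of the error functional vanishes on \<open>?r\<close>, so
      pairing \<open>?r\<close> with itself leaves the integral alone.\<close>
    have "(gk1.nrm (l i) ?r)\<^sup>2 = gint1 (\<alpha> i) ?r"
      using gk1.nrm_square[OF r] ip_residual[OF subset_UNIV r, of "X i" w] zero
      by (simp add: quad_rule_def)
    also have "\<dots> \<le> gk1.nrm (l i) ?r * e i"
      by (rule err[OF i r]) (use zero in blast)
    finally have "gk1.nrm (l i) ?r * gk1.nrm (l i) ?r \<le> gk1.nrm (l i) ?r * e i" by (simp add: power2_eq_square)
    then have "gk1.nrm (l i) ?r \<le> e i"
      using gk1.nrm_ge_0[OF r] e[OF i] by (cases "gk1.nrm (l i) ?r = 0") auto
    then have "(gk1.nrm (l i) ?r)\<^sup>2 \<le> (e i)\<^sup>2" using gk1.nrm_ge_0[OF r] by (intro power_mono)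
    moreover have "0 \<le> ?q" by (rule gk1.nonneg[OF fin[OF i] subset_UNIV])
    moreover have "0 \<le> (gk1.nrm (l i) ?r)\<^sup>2" by simp
    ultimately show ?thesis using bq rq by (intro exI[of _ w]) (simp add: P_def del: zero_le_power2)
  qed
  then have "\<forall>i\<in>{1..d}. \<exists>w. P i w" by blast
  from bchoice[OF this] obtain w where w: "\<forall>i\<in>{1..d}. P i (w i)" by blast
  define q where "q i = kform (gauss_kernel1 (l i)) (X i) (w i) (w i)" for i
  have w1: "(\<Sum>x\<in>X i. w i x * mean1 (l i) (\<alpha> i) x) = q i" and w2: "0 \<le> q i" and w3: "q i \<le> M i"
    and w4: "M i - q i \<le> (e i)\<^sup>2" if "i \<in> {1..d}" for i
    using bspec[OF w that] unfolding P_def q_def by blast+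
  \<comment> \<open>The product weights are a competitor for \<open>Q_opt\<close> on the
    grid.\<close>
  define W where "W x = (\<Prod>i=1..d. w i (x i))" for x
  interpret rkhs_functional "Rn d" "gauss_kernel d l" "rkhs_funs (Rn d) (gauss_kernel d l)"
    "snd (rkhs (Rn d) (gauss_kernel d l))" "gauss_integral d \<alpha>" "mean d l \<alpha>"
    by (rule rkhs_functional_gauss[OF \<alpha>])
  let ?G = "PiE {1..d} X"
  have GS: "?G \<subseteq> Rn d" by (intro PiE_mono) simp
  have Gfin: "finite ?G" using fin by (intro finite_PiE) auto
  have wce_eq: "worst_case_error d \<alpha> l Q = wce Q" for Q
    unfolding worst_case_error_def wce_def gk_nrm ..
  have "(\<Sum>x\<in>?G. W x * mean d l \<alpha> x) = (\<Sum>x\<in>?G. \<Prod>i=1..d. w i (x i) * mean1 (l i) (\<alpha> i) (x i))"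
  proof (rule sum.cong)
    fix x assume "x \<in> ?G"
    then have "x \<in> Rn d" using GS by blast
    then show "W x * mean d l \<alpha> x = (\<Prod>i=1..d. w i (x i) * mean1 (l i) (\<alpha> i) (x i))"
      by (simp only: W_def mean_def if_True prod.distrib)
  qed simp
  also have "\<dots> = (\<Prod>i=1..d. \<Sum>a\<in>X i. w i a * mean1 (l i) (\<alpha> i) a)"
    by (rule prod_sum_PiE[symmetric]) (use fin in auto)
  also have "\<dots> = (\<Prod>i=1..d. q i)" by (intro prod.cong w1) simp_all
  finally have b: "(\<Sum>x\<in>?G. W x * mean d l \<alpha> x) = (\<Prod>i=1..d. q i)" .
  have "kform (gauss_kernel d l) ?G W W = (\<Prod>i=1..d. q i)"
    unfolding W_def[abs_def] q_def by (rule kform_gauss_kernel_prod[OF fin])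
  \<comment> \<open>The linear and the quadratic term in \<open>residual_norm_square\<close> are the
    same product of the \<open>q i\<close>; minus two copies plus one leaves a difference of
    products.\<close>
  with b have "(gk.nrm d l (residual ?G W))\<^sup>2 = (\<Prod>i=1..d. M i) - (\<Prod>i=1..d. q i)"
    unfolding residual_norm_square[OF GS] gauss_integral_mean[OF \<alpha>] M_def by simp
  also have "\<dots> \<le> (\<Sum>i=1..d. (M i - q i) * (\<Prod>j\<in>{1..d} - {i}. M j))"
    by (intro prod_diff_le_sum conjI w2 w3 finite_atLeastAtMost)
  also have "\<dots> \<le> (\<Sum>i=1..d. (e i * (\<Prod>j\<in>{1..d} - {i}. sqrt (M j)))\<^sup>2)"
  proof (rule sum_mono)
    fix i assume i: "i \<in> {1..d}"
    have "(\<Prod>j\<in>{1..d} - {i}. sqrt (M j))\<^sup>2 = (\<Prod>j\<in>{1..d} - {i}. M j)"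
      unfolding prod_power_distrib using M0 by (intro prod.cong) auto
    moreover have "0 \<le> (\<Prod>j\<in>{1..d} - {i}. M j)" using M0 by (intro prod_nonneg) auto
    ultimately show "(M i - q i) * (\<Prod>j\<in>{1..d} - {i}. M j) \<le> (e i * (\<Prod>j\<in>{1..d} - {i}. sqrt (M j)))\<^sup>2"
      using w4[OF i] by (simp only: power_mult_distrib) (rule mult_right_mono)
  qed
  also have "\<dots> \<le> (\<Sum>i=1..d. e i * (\<Prod>j\<in>{1..d} - {i}. sqrt (M j)))\<^sup>2"
    using e M0 by (intro sum_squares_le_square_sum mult_nonneg_nonneg prod_nonneg) auto
  finally have "gk.nrm d l (residual ?G W) \<le> (\<Sum>i=1..d. e i * (\<Prod>j\<in>{1..d} - {i}. sqrt (M j)))"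
    by (rule power2_le_imp_le) (use e M0 in \<open>intro sum_nonneg mult_nonneg_nonneg prod_nonneg; auto\<close>)
  also have "\<dots> = (\<Sum>i=1..d. e i * (\<Prod>j\<in>{1..d} - {i}. (1 + 2 * (\<alpha> j)\<^sup>2 / (l j)\<^sup>2) powr (- 1 / 4)))"
  proof -
    have "sqrt (M j) = (1 + 2 * (\<alpha> j)\<^sup>2 / (l j)\<^sup>2) powr (- 1 / 4)" if "j \<in> {1..d}" for j
      unfolding M[OF that] by (simp add: powr_half_sqrt[symmetric] powr_powr)
    then show ?thesis by simp
  qed
  finally have "gk.nrm d l (residual ?G W) \<le> \<dots>" .
  moreover have "worst_case_error d \<alpha> l (Q_opt d \<alpha> l ?G) \<le> gk.nrm d l (residual ?G W)"
    unfolding Q_opt_def opt_weights_def wce_eq by (rule wce_arg_min_le[OF Gfin GS])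
  ultimately show ?thesis by linarith
qed

section \<open>Power function and fill-distance\<close>

lemma power_function_bdd:
  "bdd_above {f x |f. f \<in> rkhs_funs UNIV (gauss_kernel1 l) \<and>
     rkhs_norm UNIV (gauss_kernel1 l) f \<le> 1 \<and> (\<forall>y\<in>X. f y = 0)}"
proof (rule bdd_aboveI)
  fix z assume "z \<in> {f x |f. f \<in> rkhs_funs UNIV (gauss_kernel1 l) \<and>
     rkhs_norm UNIV (gauss_kernel1 l) f \<le> 1 \<and> (\<forall>y\<in>X. f y = 0)}"
  then obtain f where f: "z = f x" "f \<in> rkhs_funs UNIV (gauss_kernel1 l)" "gk1.nrm l f \<le> 1"
    unfolding gk1_nrm by blast
  show "z \<le> 1" using gk1_abs_le[OF f(2), of x] f by simp
qed

lemma power_function_upper: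
  assumes "f \<in> rkhs_funs UNIV (gauss_kernel1 l)" "gk1.nrm l f \<le> 1" "\<forall>y\<in>X. f y = 0"
  shows "f x \<le> power_function l X x"
  unfolding power_function_def
  using assms unfolding gk1_nrm by (intro cSup_upper power_function_bdd) blast

lemma power_function_least:
  assumes "\<And>f. f \<in> rkhs_funs UNIV (gauss_kernel1 l) \<Longrightarrow> gk1.nrm l f \<le> 1 \<Longrightarrow> \<forall>y\<in>X. f y = 0 \<Longrightarrow> f x \<le> B"
  shows "power_function l X x \<le> B"
  unfolding power_function_def
proof (rule cSup_least)
  have "gk1.nrm l (\<lambda>_. 0) \<le> 1" by (simp add: gk1.nrm_def gk1.ip_zero gk1.H_zero)
  then show "{f x |f. f \<in> rkhs_funs UNIV (gauss_kernel1 l) \<and>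
     rkhs_norm UNIV (gauss_kernel1 l) f \<le> 1 \<and> (\<forall>y\<in>X. f y = 0)} \<noteq> {}"
    using gk1.H_zero unfolding gk1_nrm by fastforce
  fix z assume "z \<in> {f x |f. f \<in> rkhs_funs UNIV (gauss_kernel1 l) \<and>
     rkhs_norm UNIV (gauss_kernel1 l) f \<le> 1 \<and> (\<forall>y\<in>X. f y = 0)}"
  then show "z \<le> B" using assms unfolding gk1_nrm by blast
qed

lemma power_function_nonneg: "0 \<le> power_function l X x"
  by (rule power_function_upper[of "\<lambda>_. 0"]) (simp_all add: gk1.nrm_def gk1.ip_zero gk1.H_zero)

lemma le_nrm_power_function:
  assumes r: "r \<in> rkhs_funs UNIV (gauss_kernel1 l)" and zero: "\<forall>y\<in>X. r y = 0"
  shows "r x \<le> gk1.nrm l r * power_function l X x"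
proof (cases "gk1.nrm l r = 0")
  case True
  then show ?thesis using gk1_abs_le[OF r, of x] by simp
next
  case False
  then have pos: "gk1.nrm l r > 0" using gk1.nrm_ge_0[OF r] by simp
  have "inverse (gk1.nrm l r) * r x \<le> power_function l X x"
  proof (rule power_function_upper)
    show "(\<lambda>x. inverse (gk1.nrm l r) * r x) \<in> rkhs_funs UNIV (gauss_kernel1 l)"
      by (rule gk1.H_scale[OF r])
    show "gk1.nrm l (\<lambda>x. inverse (gk1.nrm l r) * r x) \<le> 1"
      using pos by (simp add: gk1.nrm_scale[OF r])
  qed (use zero in simp)
  then show ?thesis using pos by (simp add: field_simps)
qed

text \<open>A supremum of an equicontinuous family: all functions of the unit ball share one modulus
  of continuity, given by the kernel. This is what makes the power function integrable on
  intervals.\<close>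

lemma isCont_power_function: "isCont (power_function l X) x"
proof -
  define D where "D y = sqrt (2 - 2 * gauss_kernel1 l y x)" for y
  have f_le: "f u \<le> f v + sqrt (2 - 2 * gauss_kernel1 l u v)"
    if "f \<in> rkhs_funs UNIV (gauss_kernel1 l)" "gk1.nrm l f \<le> 1" for f u v
  proof -
    have "0 \<le> 2 - 2 * gauss_kernel1 l u v" using gauss_kernel1_le_1[of l u v] by simp
    then have "gk1.nrm l f * sqrt (2 - 2 * gauss_kernel1 l u v) \<le> 1 * sqrt (2 - 2 * gauss_kernel1 l u v)"
      using that(2) by (intro mult_right_mono) auto
    then show ?thesis using gk1.eval_diff_le[OF that(1), of u v] by (simp add: gauss_kernel1_diag)
  qed
  have P_le: "power_function l X u \<le> power_function l X v + sqrt (2 - 2 * gauss_kernel1 l u v)" for u v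
  proof (rule power_function_least)
    fix f assume f: "f \<in> rkhs_funs UNIV (gauss_kernel1 l)" "gk1.nrm l f \<le> 1" "\<forall>y\<in>X. f y = 0"
    show "f u \<le> power_function l X v + sqrt (2 - 2 * gauss_kernel1 l u v)"
      using f_le[OF f(1,2), of u v] power_function_upper[OF f, of v] by linarith
  qed
  have "\<bar>power_function l X y - power_function l X x\<bar> \<le> D y" for y
    using P_le[of y x] P_le[of x y] unfolding D_def gauss_kernel1_commute[of l x y] by linarith
  moreover have "(D \<longlongrightarrow> 0) (at x)"
  proof -
    have "(D \<longlongrightarrow> sqrt (2 - 2 * gauss_kernel1 l x x)) (at x)"
      unfolding D_def by (intro tendsto_intros isCont_gauss_kernel1[unfolded isCont_def])
    then show ?thesis by (simp add: gauss_kernel1_diag)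
  qed
  ultimately have "((\<lambda>y. power_function l X y - power_function l X x) \<longlongrightarrow> 0) (at x)"
    using Lim_null_comparison[of "\<lambda>y. power_function l X y - power_function l X x" D "at x"] by simp
  then show ?thesis by (simp add: isCont_def LIM_zero_iff)
qed

lemma power_function_set_integrable: "set_integrable lborel {a..b} (power_function l X)"
  by (intro borel_integrable_atLeastAtMost' continuous_at_imp_continuous_on ballI isCont_power_function)

text \<open>A finite set misses some point of the interval, and its distance to finitely many nodes
  is a positive minimum, or infinite if there are none. Positivity is what allows \<open>ln\<close>
  and \<open>inverse\<close> of the fill-distance to be compared with their values at an upper
  bound.\<close>

lemma fill_distance_pos:
  assumes "finite X"
  shows "0 < fill_distance X {a..a + 1}"
proof -
  have "infinite {a..a + 1}" by simp
  then obtain x where x: "x \<in> {a..a + 1}" "x \<notin> X"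
    using finite_subset[OF _ assms] by blast
  let ?N = "X \<inter> {a..a + 1}"
  have "0 < (INF y\<in>?N. ereal \<bar>x - y\<bar>)"
  proof (cases "?N = {}")
    case True
    then show ?thesis by (simp only: image_empty Inf_empty) (simp add: top_ereal_def)
  next
    case False
    then have "Min ((\<lambda>y. ereal \<bar>x - y\<bar>) ` ?N) \<in> (\<lambda>y. ereal \<bar>x - y\<bar>) ` ?N"
      using assms by (intro Min_in) auto
    moreover have "Min ((\<lambda>y. ereal \<bar>x - y\<bar>) ` ?N) = (INF y\<in>?N. ereal \<bar>x - y\<bar>)"
      using False assms by (intro Min_Inf) auto
    ultimately have "(INF y\<in>?N. ereal \<bar>x - y\<bar>) \<in> (\<lambda>y. ereal \<bar>x - y\<bar>) ` ?N" by simp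
    then obtain y where y: "y \<in> ?N" "(INF y\<in>?N. ereal \<bar>x - y\<bar>) = ereal \<bar>x - y\<bar>" by blast
    have "x \<noteq> y" using y(1) x(2) by blast
    then show ?thesis unfolding y(2) by simp
  qed
  also have "\<dots> \<le> fill_distance X {a..a + 1}"
    unfolding fill_distance_def by (rule SUP_upper) (rule x(1))
  finally show ?thesis .
qed

text \<open>The points are given in the open unit interval, while the power function is integrated
  over closed ones. A point near or at an end is first moved inside; an arbitrarily small shift
  suffices.\<close>

lemma fill_distance_shift:
  assumes Y: "Y \<subseteq> {0<..<1}" and fill: "fill_distance Y {0<..<1} \<le> ereal r"
    and sub: "(\<lambda>x. x + a) ` Y \<subseteq> X"
  shows "fill_distance X {a..a + 1} \<le> ereal r"
  unfolding fill_distance_def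
proof (rule SUP_least)
  fix x assume x: "x \<in> {a..a + 1}"
  show "(INF y\<in>X \<inter> {a..a + 1}. ereal \<bar>x - y\<bar>) \<le> ereal r"
  proof (rule ereal_le_epsilon2)
    fix \<epsilon> :: real assume \<epsilon>: "0 < \<epsilon>"
    \<comment> \<open>One \<open>\<delta>\<close> pays for moving \<open>x - a\<close> into the open
      interval and one for missing the infimum; the cap 1/3 leaves room between
      \<open>\<delta>\<close> and \<open>1 - \<delta>\<close>.\<close>
    define \<delta> where "\<delta> = min \<epsilon> 1 / 3"
    have \<delta>: "0 < \<delta>" "\<delta> \<le> 1 / 3" "2 * \<delta> < \<epsilon>" using \<epsilon> by (auto simp: \<delta>_def)
    define z where "z = min (1 - \<delta>) (max \<delta> (x - a))"
    have z: "z \<in> {0<..<1}" and zx: "\<bar>x - a - z\<bar> \<le> \<delta>"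
      using x \<delta>(1,2) by (auto simp: z_def min_def max_def)
    have "(INF y\<in>Y \<inter> {0<..<1}. ereal \<bar>z - y\<bar>) \<le> fill_distance Y {0<..<1}"
      unfolding fill_distance_def by (rule SUP_upper) (rule z)
    also have "\<dots> < ereal (r + \<delta>)" using fill \<delta>(1) by (simp add: le_less_trans)
    finally obtain y where y: "y \<in> Y" "\<bar>z - y\<bar> < r + \<delta>"
      unfolding INF_less_iff by auto
    have "y + a \<in> X \<inter> {a..a + 1}" using y(1) Y sub by auto
    then have "(INF y\<in>X \<inter> {a..a + 1}. ereal \<bar>x - y\<bar>) \<le> ereal \<bar>x - (y + a)\<bar>" by (rule INF_lower)
    also have "\<dots> \<le> ereal (r + \<epsilon>)" using y(2) zx \<delta>(3) by simp
    finally show "(INF y\<in>X \<inter> {a..a + 1}. ereal \<bar>x - y\<bar>) \<le> ereal r + ereal \<epsilon>" by simp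
  qed
qed

text \<open>Up to 1 both - ln and the inverse are nonnegative and decreasing, and so is their
  product. Thus the unknown fill-distance can be replaced by an upper bound that is at most
  1.\<close>

lemma ln_mult_inverse_mono:
  fixes h s :: real
  assumes "0 < h" "h \<le> s" "s \<le> 1" "0 < A"
  shows "A * ln h * inverse h \<le> A * ln s * inverse s"
proof -
  have "- ln s * inverse s \<le> - ln h * inverse h"
    using assms by (intro mult_mono) (auto simp: le_imp_inverse_le)
  then have "A * (ln h * inverse h) \<le> A * (ln s * inverse s)"
    using assms(4) by (intro mult_left_mono) auto
  then show ?thesis by (simp add: mult.assoc)
qed

section \<open>The one-dimensional error\<close>

text \<open>Half of the exponent is traded for linear decay by completing the square; the other half
  remains as a normal density of doubled variance, whose total mass is 1. The factor
  \<open>sqrt 2\<close> is the ratio of the normalisations.\<close>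

lemma normal_density_tail:
  assumes a: "a > 0" and t: "t \<ge> 0" and x: "M \<le> \<bar>x\<bar>"
  shows "normal_density 0 a x \<le>
    sqrt 2 * exp (t\<^sup>2 * a\<^sup>2) * exp (- t * M) * normal_density 0 (sqrt 2 * a) x"
proof -
  have "0 \<le> (t * a - \<bar>x\<bar> / (2 * a))\<^sup>2" by simp
  also have "\<dots> = t\<^sup>2 * a\<^sup>2 - t * \<bar>x\<bar> + x\<^sup>2 / (4 * a\<^sup>2)"
    using a by (simp add: power2_diff power_mult_distrib power_divide)
  finally have "- x\<^sup>2 / (4 * a\<^sup>2) \<le> t\<^sup>2 * a\<^sup>2 - t * \<bar>x\<bar>" by simp
  also have "\<dots> \<le> t\<^sup>2 * a\<^sup>2 + - t * M" using mult_left_mono[OF x t] by simp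
  finally have "exp (- x\<^sup>2 / (4 * a\<^sup>2)) \<le> exp (t\<^sup>2 * a\<^sup>2) * exp (- t * M)"
    by (simp add: exp_add[symmetric])
  moreover have "normal_density 0 a x =
      exp (- x\<^sup>2 / (4 * a\<^sup>2)) * (sqrt 2 * normal_density 0 (sqrt 2 * a) x)"
  proof -
    have "exp (- x\<^sup>2 / (2 * a\<^sup>2)) = exp (- x\<^sup>2 / (4 * a\<^sup>2)) * exp (- x\<^sup>2 / (4 * a\<^sup>2))"
      by (simp add: exp_add[symmetric])
    then show ?thesis
      using a by (simp add: normal_density_def power_mult_distrib real_sqrt_mult field_simps)
  qed
  ultimately have "normal_density 0 a x \<le>
      (exp (t\<^sup>2 * a\<^sup>2) * exp (- t * M)) * (sqrt 2 * normal_density 0 (sqrt 2 * a) x)"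
    by (simp only:) (intro mult_right_mono mult_nonneg_nonneg, auto)
  then show ?thesis by (simp only: mult_ac)
qed

text \<open>The end \<open>real m - 1 + 1\<close> is left unsimplified so that the interval has the
  shape \<open>{a..a + 1}\<close> of the power function estimate.\<close>

lemma unit_interval_cover:
  assumes "\<bar>x\<bar> < real M"
  obtains m where "m \<in> {1..M}" "x \<in> {real m - 1..real m - 1 + 1} \<or> x \<in> {- real m..- real m + 1}"
proof (rule that)
  define n where "n = nat \<lfloor>\<bar>x\<bar>\<rfloor>"
  have n: "real n \<le> \<bar>x\<bar>" "\<bar>x\<bar> < real n + 1" unfolding n_def by linarith+
  then have "real n < real M" using assms by linarith
  then show "Suc n \<in> {1..M}" by simp
  show "x \<in> {real (Suc n) - 1..real (Suc n) - 1 + 1} \<or> x \<in> {- real (Suc n)..- real (Suc n) + 1}"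
    using n by (cases "x \<ge> 0") auto
qed

text \<open>\<open>R\<close> dominates the integrand. Inside radius \<open>M\<close> the power
  function is used, with the density replaced by its maximum \<open>g\<close>; outside,
  \<open>r\<close> is bounded by its norm. Neighbouring intervals share end points, so the
  indicators are summed: overlaps only enlarge \<open>R\<close>. The 2 counts the two
  half-lines.\<close>

lemma gint1_le_intervals:
  assumes a: "a > 0" and t: "t \<ge> 0"
    and r: "r \<in> rkhs_funs UNIV (gauss_kernel1 l)" and zero: "\<forall>y\<in>X. r y = 0"
    and J: "\<And>m. m \<in> {1..M} \<Longrightarrow> (LBINT x:{real m - 1..real m - 1 + 1}. power_function l X x) \<le> J"
      "\<And>m. m \<in> {1..M} \<Longrightarrow> (LBINT x:{- real m..- real m + 1}. power_function l X x) \<le> J"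
  shows "gint1 a r \<le> gk1.nrm l r *
    (real M * (2 / (sqrt (2 * pi) * a)) * J + sqrt 2 * exp (t\<^sup>2 * a\<^sup>2) * exp (- t * real M))"
proof -
  define P where "P = power_function l X"
  define N where "N = gk1.nrm l r"
  define g where "g = 1 / (sqrt (2 * pi) * a)"
  define B where "B = sqrt 2 * exp (t\<^sup>2 * a\<^sup>2) * exp (- t * real M)"
  define I1 where "I1 m = {real m - 1..real m - 1 + 1}" for m :: nat
  define I2 where "I2 m = {- real m..- real m + 1}" for m :: nat
  define F where "F x = (\<Sum>m\<in>{1..M}. indicator (I1 m) x * P x + indicator (I2 m) x * P x)" for x :: real
  define R where "R x = N * (g * F x + B * normal_density 0 (sqrt 2 * a) x)" for x
  have N0: "0 \<le> N" unfolding N_def by (rule gk1.nrm_ge_0[OF r])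
  have P0: "0 \<le> P x" for x unfolding P_def by (rule power_function_nonneg)
  have g0: "0 \<le> g" and B0: "0 \<le> B" using a by (auto simp: g_def B_def)
  have dens_le: "normal_density 0 a x \<le> g" for x
    using a by (simp add: normal_density_def g_def real_sqrt_mult divide_right_mono)
  have F0: "0 \<le> F x" for x unfolding F_def by (intro sum_nonneg add_nonneg_nonneg) (auto simp: P0)
  have int1: "integrable lborel (\<lambda>x. indicator (I1 m) x * P x)"
    and int2: "integrable lborel (\<lambda>x. indicator (I2 m) x * P x)" for m
    using power_function_set_integrable[of _ _ l X]
    by (simp_all add: set_integrable_def I1_def I2_def P_def)
  have intF: "integrable lborel F"
    unfolding F_def by (intro Bochner_Integration.integrable_sum Bochner_Integration.integrable_add int1 int2)
  have a2: "0 < sqrt 2 * a" using a by simp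
  have intR: "integrable lborel R"
    unfolding R_def using intF a2
    by (intro integrable_mult_right Bochner_Integration.integrable_add) auto
  have "gint1 a r \<le> (\<integral>x. R x \<partial>lborel)"
    unfolding gint1_def
  proof (rule integral_mono[OF gk1_integrable[OF a r] intR])
    fix x
    show "r x * normal_density 0 a x \<le> R x"
    proof (cases "\<bar>x\<bar> < real M")
      case True
      then obtain m where m: "m \<in> {1..M}" "x \<in> I1 m \<or> x \<in> I2 m"
        unfolding I1_def I2_def by (rule unit_interval_cover)
      have "P x \<le> indicator (I1 m) x * P x + indicator (I2 m) x * P x"
        using m(2) P0[of x] by (auto simp: indicator_def)
      also have "\<dots> \<le> F x" unfolding F_def
        by (rule member_le_sum[OF m(1)]) (auto simp: P0)
      finally have PF: "P x \<le> F x" .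
      have "r x * normal_density 0 a x \<le> (N * P x) * normal_density 0 a x"
        unfolding N_def P_def by (intro mult_right_mono le_nrm_power_function[OF r zero]) simp
      also have "\<dots> \<le> (N * F x) * g"
        by (intro mult_mono mult_left_mono PF dens_le mult_nonneg_nonneg N0 F0) auto
      also have "\<dots> \<le> R x" unfolding R_def using N0 B0 by (simp add: algebra_simps)
      finally show ?thesis .
    next
      case False
      have "r x * normal_density 0 a x \<le> N * normal_density 0 a x"
        using gk1_abs_le[OF r, of x] unfolding N_def by (intro mult_right_mono) auto
      also have "\<dots> \<le> N * (B * normal_density 0 (sqrt 2 * a) x)"
        unfolding B_def using False by (intro mult_left_mono normal_density_tail[OF a t] N0) auto
      also have "\<dots> \<le> R x" unfolding R_def using N0 g0 F0[of x] by (simp add: algebra_simps)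
      finally show ?thesis .
    qed
  qed
  also have "\<dots> = N * (g * (\<integral>x. F x \<partial>lborel) + B)"
    unfolding R_def using intF a2 by (subst integral_mult_right_zero, subst Bochner_Integration.integral_add) auto
  also have "\<dots> \<le> N * (g * (real M * (2 * J)) + B)"
  proof (intro mult_left_mono add_right_mono N0 g0)
    have "(\<integral>x. F x \<partial>lborel) = (\<Sum>m\<in>{1..M}. (\<integral>x. indicator (I1 m) x * P x \<partial>lborel) + (\<integral>x. indicator (I2 m) x * P x \<partial>lborel))"
      unfolding F_def using int1 int2 by simp
    also have "\<dots> \<le> (\<Sum>m\<in>{1..M}. 2 * J)"
    proof (rule sum_mono)
      fix m assume m: "m \<in> {1..M}"
      show "(\<integral>x. indicator (I1 m) x * P x \<partial>lborel) + (\<integral>x. indicator (I2 m) x * P x \<partial>lborel) \<le> 2 * J"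
        using J(1)[OF m] J(2)[OF m] by (simp add: set_lebesgue_integral_def I1_def I2_def P_def)
    qed
    finally show "(\<integral>x. F x \<partial>lborel) \<le> real M * (2 * J)" by simp
  qed
  finally show ?thesis by (simp add: N_def g_def B_def mult_ac)
qed

section \<open>The point sets\<close>

lemma finite_X_points:
  assumes "\<forall>m\<ge>1. finite (Y m)"
  shows "finite (X_points Y k)"
  unfolding X_points_def shift_pos_def shift_neg_def using assms by auto

text \<open>At most \<open>k\<close> points in each of \<open>2 * k\<close> shifted copies: a crude
  count, and the source of the factor \<open>2 * sqrt 2\<close> in the final exponent.\<close>

lemma card_X_points_le:
  assumes "\<forall>m\<ge>1. finite (Y m) \<and> card (Y m) = m"
  shows "card (X_points Y k) \<le> 2 * k\<^sup>2"
proof -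
  have "card (X_points Y k) \<le> (\<Sum>m\<in>{1..k}. card (shift_pos Y (k - m + 1) m \<union> shift_neg Y (k - m + 1) m))"
    unfolding X_points_def by (rule card_UN_le) simp
  also have "\<dots> \<le> (\<Sum>m\<in>{1..k}. 2 * k)"
  proof (rule sum_mono)
    fix m assume m: "m \<in> {1..k}"
    have "card (shift_pos Y (k - m + 1) m \<union> shift_neg Y (k - m + 1) m) \<le>
        card (shift_pos Y (k - m + 1) m) + card (shift_neg Y (k - m + 1) m)" by (rule card_Un_le)
    also have "\<dots> \<le> card (Y (k - m + 1)) + card (Y (k - m + 1))"
      unfolding shift_pos_def shift_neg_def using assms by (intro add_mono card_image_le) auto
    also have "\<dots> \<le> 2 * k" using assms m by auto
    finally show "card (shift_pos Y (k - m + 1) m \<union> shift_neg Y (k - m + 1) m) \<le> 2 * k" .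
  qed
  also have "\<dots> = 2 * k\<^sup>2" by (simp add: power2_eq_square)
  finally show ?thesis .
qed

text \<open>The intervals with index \<open>m\<close> hold a copy of \<open>Y p\<close> for
  \<open>p = k - m + 1\<close>; up to the middle index \<open>p\<close> is at least k/2.\<close>

lemma fill_distance_X_points:
  assumes Y: "\<forall>m\<ge>1. Y m \<subseteq> {0<..<1} \<and> fill_distance (Y m) {0<..<1} \<le> ereal (c / real m)"
    and c: "c > 0" and m: "m \<in> {1..(k + 1) div 2}"
  shows "fill_distance (X_points Y k) {real m - 1..real m - 1 + 1} \<le> ereal (2 * c / real k)"
    and "fill_distance (X_points Y k) {- real m..- real m + 1} \<le> ereal (2 * c / real k)"
proof -
  define p where "p = k - m + 1"
  have p: "1 \<le> p" and mk: "m \<in> {1..k}" and k: "k \<ge> 1" and "k \<le> 2 * p" using m by (auto simp: p_def)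
  then have "real k \<le> 2 * real p" by linarith
  then have "c / real p \<le> 2 * c / real k" using c p k by (simp add: field_simps)
  then have fill: "fill_distance (Y p) {0<..<1} \<le> ereal (2 * c / real k)"
    using Y p by (meson ereal_less_eq(3) order_trans)
  have Yp: "Y p \<subseteq> {0<..<1}" using Y p by blast
  have sub: "shift_pos Y p m \<union> shift_neg Y p m \<subseteq> X_points Y k"
    unfolding X_points_def p_def using mk by blast
  show "fill_distance (X_points Y k) {real m - 1..real m - 1 + 1} \<le> ereal (2 * c / real k)"
    by (rule fill_distance_shift[OF Yp fill]) (use sub in \<open>auto simp: shift_pos_def add_diff_eq\<close>)
  show "fill_distance (X_points Y k) {- real m..- real m + 1} \<le> ereal (2 * c / real k)"
    by (rule fill_distance_shift[OF Yp fill]) (use sub in \<open>auto simp: shift_neg_def\<close>)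
qed

text \<open>The exponent is of order - k ln k and beats any multiple of \<open>k\<close>. The
  finitely many early \<open>k\<close> are absorbed into a constant that depends only on
  \<open>A\<close>, \<open>B\<close> and \<open>c\<close>.\<close>

lemma superexponential_bound:
  fixes A B c :: real
  assumes "A > 0" "c > 0"
  shows "\<exists>C>0. \<forall>k\<ge>1. (real k + 1) * exp (A * ln (2 * c / real k) * inverse (2 * c / real k)) \<le> C * exp (- B * real k)"
proof -
  define f where "f k = (real k + 1) * exp (A * ln (2 * c / real k) * inverse (2 * c / real k) + B * real k)" for k :: nat
  \<comment> \<open>Once ln (k / (2 c)) is at least \<open>D\<close>, the exponent is at most - (B +
    1) k; the extra decay exp (- k) pays for the factor \<open>real k + 1\<close>.\<close>
  define D where "D = (B + 1) * (2 * c) / A"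
  define N where "N = nat \<lceil>2 * c * exp D\<rceil>"
  define C where "C = 1 + (\<Sum>j<N. \<bar>f j\<bar>)"
  have f_le: "f k \<le> C" if k: "k \<ge> 1" for k
  proof (cases "k < N")
    case True
    then have "\<bar>f k\<bar> \<le> (\<Sum>j<N. \<bar>f j\<bar>)" by (intro member_le_sum) auto
    then show ?thesis by (simp add: C_def)
  next
    case False
    then have "2 * c * exp D \<le> real k" unfolding N_def by linarith
    then have "exp D \<le> real k / (2 * c)" using assms by (simp add: field_simps)
    then have "D \<le> ln (real k / (2 * c))" using assms k by (subst ln_ge_iff) auto
    also have "\<dots> = - ln (2 * c / real k)" using assms k by (simp add: ln_div)
    finally have "A * D \<le> A * (- ln (2 * c / real k))"
      by (rule mult_left_mono) (use assms(1) in simp)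
    then have "A * ln (2 * c / real k) \<le> - (A * D)" by simp
    then have "(A * ln (2 * c / real k)) * inverse (2 * c / real k) \<le> - (A * D) * inverse (2 * c / real k)"
      using assms k by (intro mult_right_mono) auto
    also have "\<dots> = - ((B + 1) * real k)" using assms k by (simp add: D_def)
    finally have "f k \<le> (real k + 1) * exp (- real k)"
      unfolding f_def by (intro mult_left_mono) (auto simp: algebra_simps)
    also have "\<dots> \<le> exp (real k) * exp (- real k)"
      using exp_ge_add_one_self[of "real k"] by (intro mult_right_mono) (auto simp: add.commute)
    also have "\<dots> = 1" by (simp add: exp_add[symmetric])
    also have "1 \<le> C" by (simp add: C_def sum_nonneg)
    finally show ?thesis .
  qed
  show ?thesis
  proof (intro exI[of _ C] conjI allI impI)
    show "C > 0" by (simp add: C_def sum_nonneg add_pos_nonneg)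
    fix k :: nat assume k: "k \<ge> 1"
    have "(real k + 1) * exp (A * ln (2 * c / real k) * inverse (2 * c / real k)) = f k * exp (- B * real k)"
      by (simp add: f_def exp_add exp_minus)
    also have "\<dots> \<le> C * exp (- B * real k)" using f_le[OF k] by (intro mult_right_mono) auto
    finally show "(real k + 1) * exp (A * ln (2 * c / real k) * inverse (2 * c / real k)) \<le> C * exp (- B * real k)" .
  qed
qed

lemma one_dimensional_error:
  fixes A h0 :: "real \<Rightarrow> real"
  assumes A: "A l > 0" and h0: "h0 l \<le> 1"
    and power: "\<And>(a::real) (X::real set). finite X \<Longrightarrow> fill_distance X {a..a + 1} \<le> ereal (h0 l) \<Longrightarrow>
           (LBINT x:{a..a + 1}. power_function l X x)
             \<le> exp (A l * ln (real_of_ereal (fill_distance X {a..a + 1}))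
                        * inverse (real_of_ereal (fill_distance X {a..a + 1})))"
    and a: "a > 0" and c: "c > 0" and k: "k \<ge> 1" "2 * c / real k \<le> h0 l"
    and Y: "\<forall>m\<ge>1. Y m \<subseteq> {0<..<1} \<and> finite (Y m) \<and> fill_distance (Y m) {0<..<1} \<le> ereal (c / real m)"
    and r: "r \<in> rkhs_funs UNIV (gauss_kernel1 l)" and zero: "\<forall>y\<in>X_points Y k. r y = 0"
  shows "gint1 a r \<le> gk1.nrm l r *
    ((real k + 1) * exp (A l * ln (2 * c / real k) * inverse (2 * c / real k)) * (2 / (sqrt (2 * pi) * a))
      + sqrt 2 * exp (1 / a\<^sup>2) * exp (- (1 / (2 * a\<^sup>2)) * real k))"
proof -
  let ?s = "2 * c / real k" and ?X = "X_points Y k" and ?M = "(k + 1) div 2"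
  let ?J = "exp (A l * ln ?s * inverse ?s)"
  have s: "0 < ?s" using c k by simp
  have X: "finite ?X" using Y by (intro finite_X_points) blast
  have *: "(LBINT x:{b..b + 1}. power_function l ?X x) \<le> ?J"
    if fill: "fill_distance ?X {b..b + 1} \<le> ereal ?s" for b
  proof -
    define h where "h = real_of_ereal (fill_distance ?X {b..b + 1})"
    have pos: "0 < fill_distance ?X {b..b + 1}" by (rule fill_distance_pos[OF X])
    have h: "ereal h = fill_distance ?X {b..b + 1}"
      unfolding h_def using pos fill by (cases "fill_distance ?X {b..b + 1}") auto
    have "0 < h" "h \<le> ?s" using pos fill unfolding h[symmetric] by simp_all
    have "fill_distance ?X {b..b + 1} \<le> ereal (h0 l)"
      using order_trans[OF fill] k(2) by simp
    from power[OF X this]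
    have "(LBINT x:{b..b + 1}. power_function l ?X x) \<le> exp (A l * ln h * inverse h)"
      unfolding h_def .
    also have "\<dots> \<le> ?J"
      using ln_mult_inverse_mono[OF \<open>0 < h\<close> \<open>h \<le> ?s\<close> _ A] k(2) h0 by simp
    finally show ?thesis .
  qed
  have Y': "\<forall>m\<ge>1. Y m \<subseteq> {0<..<1} \<and> fill_distance (Y m) {0<..<1} \<le> ereal (c / real m)"
    using Y by blast
  \<comment> \<open>Here \<open>t = 1 / a^2\<close>. The radius \<open>?M\<close> is k/2 rounded up:
    large enough for the tail to decay like exp (- k / (2 a^2)), and still within reach of
    \<open>fill_distance_X_points\<close>.\<close>
  have "gint1 a r \<le> gk1.nrm l r * (real ?M * (2 / (sqrt (2 * pi) * a)) * ?J
      + sqrt 2 * exp ((1 / a\<^sup>2)\<^sup>2 * a\<^sup>2) * exp (- (1 / a\<^sup>2) * real ?M))"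
    by (rule gint1_le_intervals[OF a _ r zero])
      (simp_all only: * fill_distance_X_points[OF Y' c], use a in simp)
  also have "\<dots> \<le> gk1.nrm l r * ((real k + 1) * ?J * (2 / (sqrt (2 * pi) * a))
      + sqrt 2 * exp (1 / a\<^sup>2) * exp (- (1 / (2 * a\<^sup>2)) * real k))"
  proof (intro mult_left_mono add_mono gk1.nrm_ge_0[OF r])
    have "real ?M \<le> real k + 1" by linarith
    then have "real ?M * (?J * (2 / (sqrt (2 * pi) * a))) \<le> (real k + 1) * (?J * (2 / (sqrt (2 * pi) * a)))"
      using a by (intro mult_right_mono mult_nonneg_nonneg) auto
    then show "real ?M * (2 / (sqrt (2 * pi) * a)) * ?J \<le> (real k + 1) * ?J * (2 / (sqrt (2 * pi) * a))"
      by (simp only: mult_ac)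
    have "real k / 2 \<le> real ?M" by linarith
    then have "(1 / a\<^sup>2) * (real k / 2) \<le> (1 / a\<^sup>2) * real ?M" by (rule mult_left_mono) simp
    then have "exp (- (1 / a\<^sup>2) * real ?M) \<le> exp (- (1 / (2 * a\<^sup>2)) * real k)" by simp
    moreover have "(1 / a\<^sup>2)\<^sup>2 * a\<^sup>2 = 1 / a\<^sup>2" using a by (simp add: power2_eq_square)
    ultimately show "sqrt 2 * exp ((1 / a\<^sup>2)\<^sup>2 * a\<^sup>2) * exp (- (1 / a\<^sup>2) * real ?M)
        \<le> sqrt 2 * exp (1 / a\<^sup>2) * exp (- (1 / (2 * a\<^sup>2)) * real k)"
      by (simp only:) (rule mult_left_mono, auto)
  qed
  finally show ?thesis .
qed

section \<open>The error on product grids\<close>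

text \<open>\<open>C\<close> is quantified before the dimension, the point sets and
  \<open>k\<close>, which expresses that each constant depends only on \<open>l i\<close>,
  \<open>\<alpha> i\<close> and \<open>c_qu\<close>; \<open>A\<close> and \<open>h0\<close> are
  fixed outside.\<close>

theorem theorem3p4:
  fixes A h0 :: "real \<Rightarrow> real"
  assumes "\<And>l. l > 0 \<Longrightarrow> A l > 0"
    and "\<And>l. l > 0 \<Longrightarrow> 0 < h0 l \<and> h0 l \<le> 1"
    and "\<And>(l::real) (a::real) (X::real set).
           l > 0 \<Longrightarrow> finite X \<Longrightarrow> fill_distance X {a..a + 1} \<le> ereal (h0 l) \<Longrightarrow>
           (LBINT x:{a..a + 1}. power_function l X x)
             \<le> exp (A l * ln (real_of_ereal (fill_distance X {a..a + 1}))
                        * inverse (real_of_ereal (fill_distance X {a..a + 1})))"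
  shows "\<exists>C :: real \<Rightarrow> real \<Rightarrow> real \<Rightarrow> real.
    (\<forall>l>0. \<forall>a>0. \<forall>c>0. C l a c > 0) \<and>
    (\<forall>(d::nat) (\<alpha> :: nat \<Rightarrow> real) (l :: nat \<Rightarrow> real) (Y :: nat \<Rightarrow> real set) (c_qu::real) (k :: nat \<Rightarrow> nat).
       d \<ge> 1 \<longrightarrow>
       (\<forall>i\<in>{1..d}. \<alpha> i > 0 \<and> l i > 0) \<longrightarrow>
       c_qu > 0 \<longrightarrow>
       (\<forall>m\<ge>1. Y m \<subseteq> {0<..<1} \<and> finite (Y m) \<and> card (Y m) = m \<and>
               fill_distance (Y m) {0<..<1} \<le> ereal (c_qu / real m)) \<longrightarrow>
       (\<forall>i\<in>{1..d}. k i \<ge> 1) \<longrightarrow>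
       (\<forall>i\<in>{1..d}. real (k i) \<ge> 2 * c_qu * inverse (min (h0 (l i)) (inverse c_qu))) \<longrightarrow>
       worst_case_error d \<alpha> l (Q_opt d \<alpha> l (X_grid Y d k))
         \<le> (\<Sum>i=1..d. C (l i) (\<alpha> i) c_qu
               * (\<Prod>j\<in>{1..d} - {i}. (1 + 2 * (\<alpha> j)\<^sup>2 / (l j)\<^sup>2) powr (- 1 / 4))
               * exp (- sqrt (real (card (X_points Y (k i)))) / (2 * sqrt 2 * (\<alpha> i)\<^sup>2))))"
proof -
  define E where "E l a c k = (real k + 1) * exp (A l * ln (2 * c / real k) * inverse (2 * c / real k)) * (2 / (sqrt (2 * pi) * a))
      + sqrt 2 * exp (1 / a\<^sup>2) * exp (- (1 / (2 * a\<^sup>2)) * real k)" for l a c :: real and k :: nat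
  define good where "good l a c C \<longleftrightarrow> C > 0 \<and> (\<forall>k\<ge>1. E l a c k \<le> C * exp (- (1 / (2 * a\<^sup>2)) * real k))" for l a c C :: real
  \<comment> \<open>Chosen from \<open>l\<close>, \<open>a\<close> and \<open>c\<close> alone,
    before any grid is introduced; for positive arguments a good constant exists.\<close>
  define C where "C l a c = (SOME C. good l a c C)" for l a c
  have good: "good l a c (C l a c)" if lac: "l > 0" "a > 0" "c > 0" for l a c
  proof -
    obtain C0 where C0: "C0 > 0" "\<forall>k\<ge>1. (real k + 1) * exp (A l * ln (2 * c / real k) * inverse (2 * c / real k)) \<le> C0 * exp (- (1 / (2 * a\<^sup>2)) * real k)"
      using superexponential_bound[OF assms(1)[OF lac(1)] lac(3)] by blast
    define D where "D = C0 * (2 / (sqrt (2 * pi) * a)) + sqrt 2 * exp (1 / a\<^sup>2)"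
    have "E l a c k \<le> D * exp (- (1 / (2 * a\<^sup>2)) * real k)" if k: "k \<ge> 1" for k
    proof -
      have "(real k + 1) * exp (A l * ln (2 * c / real k) * inverse (2 * c / real k)) * (2 / (sqrt (2 * pi) * a))
          \<le> C0 * exp (- (1 / (2 * a\<^sup>2)) * real k) * (2 / (sqrt (2 * pi) * a))"
        using C0(2) k \<open>a > 0\<close> by (intro mult_right_mono) auto
      then show ?thesis unfolding E_def D_def by (simp add: algebra_simps)
    qed
    moreover have "D > 0" unfolding D_def using C0(1) lac by (intro add_pos_pos mult_pos_pos) auto
    ultimately have "good l a c D" unfolding good_def by blast
    then show ?thesis unfolding C_def by (rule someI)
  qed
  show ?thesis
  proof (intro exI[of _ C] conjI allI impI)
    show "C l a c > 0" if "l > 0" "a > 0" "c > 0" for l a c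
      using good[OF that] unfolding good_def by blast
  next
    fix d :: nat and \<alpha> l :: "nat \<Rightarrow> real" and Y :: "nat \<Rightarrow> real set" and c :: real and k :: "nat \<Rightarrow> nat"
    assume pos: "\<forall>i\<in>{1..d}. \<alpha> i > 0 \<and> l i > 0" and c: "c > 0"
      and Y: "\<forall>m\<ge>1. Y m \<subseteq> {0<..<1} \<and> finite (Y m) \<and> card (Y m) = m \<and>
               fill_distance (Y m) {0<..<1} \<le> ereal (c / real m)"
      and k1: "\<forall>i\<in>{1..d}. k i \<ge> 1"
      and k2: "\<forall>i\<in>{1..d}. real (k i) \<ge> 2 * c * inverse (min (h0 (l i)) (inverse c))"
    define e where "e i = E (l i) (\<alpha> i) c (k i)" for i
    let ?p = "\<lambda>i. \<Prod>j\<in>{1..d} - {i}. (1 + 2 * (\<alpha> j)\<^sup>2 / (l j)\<^sup>2) powr (- 1 / 4)"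
    have Y1: "\<forall>m\<ge>1. finite (Y m)" and Y2: "\<forall>m\<ge>1. finite (Y m) \<and> card (Y m) = m"
      and Y3: "\<forall>m\<ge>1. Y m \<subseteq> {0<..<1} \<and> finite (Y m) \<and> fill_distance (Y m) {0<..<1} \<le> ereal (c / real m)"
      using Y by blast+
    have "worst_case_error d \<alpha> l (Q_opt d \<alpha> l (PiE {1..d} (\<lambda>i. X_points Y (k i)))) \<le> (\<Sum>i=1..d. e i * ?p i)"
    proof (rule worst_case_error_grid)
      show "\<alpha> i > 0 \<and> l i > 0" if "i \<in> {1..d}" for i using pos that by blast
      show "finite (X_points Y (k i))" for i by (rule finite_X_points[OF Y1])
      show "0 \<le> e i" if "i \<in> {1..d}" for i
        using bspec[OF pos that] by (simp add: e_def E_def)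
      fix i r assume i: "i \<in> {1..d}" and r: "r \<in> rkhs_funs UNIV (gauss_kernel1 (l i))"
        and zero: "\<And>x. x \<in> X_points Y (k i) \<Longrightarrow> r x = 0"
      have li: "l i > 0" and ai: "\<alpha> i > 0" using pos i by auto
      have h: "0 < h0 (l i)" "h0 (l i) \<le> 1" using assms(2)[OF li] by auto
      let ?h = "min (h0 (l i)) (inverse c)"
      have hp: "0 < ?h" using h c by simp
      have "2 * c / ?h \<le> real (k i)" using bspec[OF k2 i] by (simp add: divide_inverse)
      then have "2 * c \<le> ?h * real (k i)" by (simp only: pos_divide_le_eq[OF hp] mult.commute)
      then have "2 * c / real (k i) \<le> ?h" using bspec[OF k1 i] by (simp only: pos_divide_le_eq of_nat_0_less_iff)
      then have kh: "2 * c / real (k i) \<le> h0 (l i)" by simp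
      show "gint1 (\<alpha> i) r \<le> gk1.nrm (l i) r * e i"
        unfolding e_def E_def
        by (rule one_dimensional_error[where A = A and ?h0.0 = h0 and Y = Y, OF assms(1)[OF li] h(2)
              assms(3)[OF li] ai c bspec[OF k1 i] kh Y3 r])
          (use zero in auto)
    qed
    also have "\<dots> \<le> (\<Sum>i=1..d. C (l i) (\<alpha> i) c * ?p i
        * exp (- sqrt (real (card (X_points Y (k i)))) / (2 * sqrt 2 * (\<alpha> i)\<^sup>2)))"
    proof (rule sum_mono)
      fix i assume i: "i \<in> {1..d}"
      have li: "l i > 0" and ai: "\<alpha> i > 0" using pos i by auto
      let ?n = "card (X_points Y (k i))"
      have Cpos: "0 < C (l i) (\<alpha> i) c" and
        "e i \<le> C (l i) (\<alpha> i) c * exp (- (1 / (2 * (\<alpha> i)\<^sup>2)) * real (k i))"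
        using good[OF li ai c] bspec[OF k1 i] unfolding good_def e_def by blast+
      note this(2)
      also have "\<dots> \<le> C (l i) (\<alpha> i) c * exp (- sqrt (real ?n) / (2 * sqrt 2 * (\<alpha> i)\<^sup>2))"
      proof (intro mult_left_mono)
        \<comment> \<open>The count of points is inverted: \<open>k\<close> is at least sqrt(n / 2),
          so decay in \<open>k\<close> becomes decay in the root of \<open>n\<close>.\<close>
        have "real ?n \<le> 2 * (real (k i))\<^sup>2"
          using card_X_points_le[OF Y2, of "k i"] by (metis of_nat_le_iff of_nat_mult of_nat_numeral of_nat_power)
        then have "sqrt (real ?n) \<le> sqrt 2 * real (k i)"
          using real_sqrt_le_mono by (fastforce simp: real_sqrt_mult)
        then have "sqrt (real ?n) / (2 * sqrt 2 * (\<alpha> i)\<^sup>2) \<le> sqrt 2 * real (k i) / (2 * sqrt 2 * (\<alpha> i)\<^sup>2)"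
          by (rule divide_right_mono) simp
        then show "exp (- (1 / (2 * (\<alpha> i)\<^sup>2)) * real (k i)) \<le> exp (- sqrt (real ?n) / (2 * sqrt 2 * (\<alpha> i)\<^sup>2))"
          by simp
      qed (use Cpos in simp)
      finally have "e i * ?p i \<le> (C (l i) (\<alpha> i) c * exp (- sqrt (real ?n) / (2 * sqrt 2 * (\<alpha> i)\<^sup>2))) * ?p i"
        by (rule mult_right_mono) (intro prod_nonneg, simp)
      then show "e i * ?p i \<le> C (l i) (\<alpha> i) c * ?p i * exp (- sqrt (real ?n) / (2 * sqrt 2 * (\<alpha> i)\<^sup>2))"
        by (simp only: mult_ac)
    qed
    finally show "worst_case_error d \<alpha> l (Q_opt d \<alpha> l (X_grid Y d k)) \<le>
        (\<Sum>i=1..d. C (l i) (\<alpha> i) c * ?p i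
        * exp (- sqrt (real (card (X_points Y (k i)))) / (2 * sqrt 2 * (\<alpha> i)\<^sup>2)))"
      unfolding X_grid_def .
  qed
qed

end
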